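(* For the split-merge random walk on the partitions of $N$ with the metric $d$, one has $\kappa_1>0$, and thus $\kappa_i>0$ for every $i\ge1$. Moreover, there exist universal constants $\alpha>0$ and $0<\beta<1$ (not depending on $N$) such that $\kappa_k\ge\beta$ for every integer $k\ge(\alpha+1/2)N$.
   Context: Let $N$ be a positive integer. $\Omega$ is the set of partitions of $N$, i.e. tuples $(a_1,\ldots,a_m)$ of positive integers with $a_1\ge\cdots\ge a_m$ and $\sum_i a_i=N$ (considered as multisets of parts). The split-merge random walk on $\Omega$: from $(a_1,\ldots,a_m)$, (1) split: $a_i$ is replaced by the two parts $r,\ a_i-r$ with probability $a_i/N^2$, for every $1\le i\le m$, $1\le r\le a_i-1$; (2) merge: $a_i$ and $a_j$ are replaced by $a_i+a_j$ with probability $2a_ia_j/N^2$, for every $1\le i<j\le m$; (3) stay in place with probability $1/N$. (Parts are re-sorted after each step; probabilities of moves leading to the same partition add up.) The distance $d(x,y)$ is the minimal number of splits or merges required to get from $x$ to $y$. With $P$ the kernel of this walk and $P^k_x$ the law after $k$ steps from $x$, $W_1(\mu_1,\mu_2)=\inf\mathbb{E}(d(X,Y))$ over couplings $(X,Y)$ of $\mu_1,\mu_2$; $\kappa_k(x,y)=1-W_1(P^k_x,P^k_y)/d(x,y)$ for $x\ne y$, $\kappa_k(x,x)=1$, and $\kappa_k=\inf_{x,y\in\Omega}\kappa_k(x,y)$. *)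

theory Defs
  imports "HOL-Probability.Probability"
begin

definition couplings :: "'a pmf \<Rightarrow> 'a pmf \<Rightarrow> ('a \<times> 'a) pmf set" where
  "couplings \<mu>\<^sub>1 \<mu>\<^sub>2 = {\<pi>. map_pmf fst \<pi> = \<mu>\<^sub>1 \<and> map_pmf snd \<pi> = \<mu>\<^sub>2}"

text \<open>
  The infimum is taken in \<open>real\<close>. It is meaningful when \<open>d\<close> is nonnegative and the laws have
  finite support: then the expectations exist and are bounded below, and
  \<^const>\<open>couplings\<close> contains the product coupling.
\<close>

definition W1 :: "('a \<Rightarrow> 'a \<Rightarrow> real) \<Rightarrow> 'a pmf \<Rightarrow> 'a pmf \<Rightarrow> real" where
  "W1 d \<mu>\<^sub>1 \<mu>\<^sub>2 =
     (INF \<pi>\<in>couplings \<mu>\<^sub>1 \<mu>\<^sub>2. measure_pmf.expectation \<pi> (\<lambda>(X, Y). d X Y))"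

primrec iterate_kernel :: "('a \<Rightarrow> 'a pmf) \<Rightarrow> nat \<Rightarrow> 'a \<Rightarrow> 'a pmf" where
  "iterate_kernel P 0 x = return_pmf x"
| "iterate_kernel P (Suc k) x = bind_pmf (iterate_kernel P k x) P"

definition curvature_at ::
    "('a \<Rightarrow> 'a pmf) \<Rightarrow> ('a \<Rightarrow> 'a \<Rightarrow> real) \<Rightarrow> nat \<Rightarrow> 'a \<Rightarrow> 'a \<Rightarrow> real" where
  "curvature_at P d k x y =
     (if x = y then 1
      else 1 - W1 d (iterate_kernel P k x) (iterate_kernel P k y) / d x y)"

definition curvature ::
    "'a set \<Rightarrow> ('a \<Rightarrow> 'a pmf) \<Rightarrow> ('a \<Rightarrow> 'a \<Rightarrow> real) \<Rightarrow> nat \<Rightarrow> real" where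
  "curvature \<Omega> P d k = (INF (x, y)\<in>\<Omega> \<times> \<Omega>. curvature_at P d k x y)"

definition partitions :: "nat \<Rightarrow> nat multiset set" where
  "partitions N = {x. (\<forall>a\<in>#x. 0 < a) \<and> sum_mset x = N}"

text \<open>The tuple \<open>a\<^sub>1 \<ge> \<dots> \<ge> a\<^sub>m\<close> of the parts, indexed from 0.\<close>

definition parts :: "nat multiset \<Rightarrow> nat list" where
  "parts x = rev (sorted_list_of_multiset x)"

definition split_part :: "nat multiset \<Rightarrow> nat \<Rightarrow> nat \<Rightarrow> nat multiset" where
  "split_part x a r = x - {#a#} + {#r, a - r#}"

definition merge_parts :: "nat multiset \<Rightarrow> nat \<Rightarrow> nat \<Rightarrow> nat multiset" where
  "merge_parts x a b = x - {#a, b#} + {#a + b#}"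

definition moves :: "nat \<Rightarrow> nat multiset \<Rightarrow> (nat multiset \<times> real) list" where
  "moves N x =
     (let a = parts x; m = length a in
        [(split_part x (a ! i) r, real (a ! i) / real N ^ 2).
           i \<leftarrow> [0..<m], r \<leftarrow> [1..<a ! i]]
      @ [(merge_parts x (a ! i) (a ! j), 2 * real (a ! i) * real (a ! j) / real N ^ 2).
           i \<leftarrow> [0..<m], j \<leftarrow> [Suc i..<m]]
      @ [(x, 1 / real N)])"

text \<open>
  In \<^const>\<open>pmf_of_list\<close> the weights of equal outcomes add up. The list is a genuine probability
  distribution for \<open>x \<in> partitions N\<close>, see \<open>moves_wf\<close> below; other arguments are irrelevant.
\<close>

definition split_merge_kernel :: "nat \<Rightarrow> nat multiset \<Rightarrow> nat multiset pmf" where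
  "split_merge_kernel N x = pmf_of_list (moves N x)"

definition split_or_merge :: "nat multiset \<Rightarrow> nat multiset \<Rightarrow> bool" where
  "split_or_merge x y \<longleftrightarrow>
     (\<exists>a r. a \<in># x \<and> 1 \<le> r \<and> r < a \<and> y = split_part x a r) \<or>
     (\<exists>a b. {#a, b#} \<subseteq># x \<and> y = merge_parts x a b)"

text \<open>
  The minimum is over a nonempty set for two partitions of the same number,
  see \<open>split_or_merge_connected\<close> below.
\<close>

definition split_merge_dist :: "nat multiset \<Rightarrow> nat multiset \<Rightarrow> real" where
  "split_merge_dist x y = real (LEAST n. (split_or_merge ^^ n) x y)"

definition split_merge_curvature :: "nat \<Rightarrow> nat \<Rightarrow> real" where
  "split_merge_curvature N = curvature (partitions N) (split_merge_kernel N) split_merge_dist"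

lemma sum_list_pairs:
  fixes l :: "real list"
  shows "(\<Sum>i\<leftarrow>[0..<length l]. \<Sum>j\<leftarrow>[Suc i..<length l]. 2 * l ! i * l ! j)
         = (sum_list l)^2 - (\<Sum>z\<leftarrow>l. z^2)"
proof (induction l)
  case Nil
  show ?case by simp
next
  case (Cons z l)
  have "(\<Sum>j\<leftarrow>[Suc 0..<Suc (length l)]. 2 * z * (z # l) ! j) = 2 * z * sum_list l"
  proof -
    have "map (\<lambda>j. 2 * z * (z # l) ! j) [Suc 0..<Suc (length l)]
          = map (\<lambda>y. 2 * z * y) l"
      by (rule nth_equalityI) (auto simp del: upt_Suc)
    then show ?thesis by (simp add: sum_list_const_mult del: upt_Suc)
  qed
  moreover have "(\<Sum>i\<leftarrow>[Suc 0..<Suc (length l)]. \<Sum>j\<leftarrow>[Suc i..<Suc (length l)].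
                   2 * (z # l) ! i * (z # l) ! j)
      = (\<Sum>i\<leftarrow>[0..<length l]. \<Sum>j\<leftarrow>[Suc i..<length l]. 2 * l ! i * l ! j)"
    by (simp add: map_Suc_upt[symmetric] o_def del: upt_Suc)
  moreover have "[0..<length (z # l)] = 0 # [Suc 0..<Suc (length l)]"
    by (simp add: upt_conv_Cons del: upt_Suc)
  ultimately show ?case
    using Cons.IH by (simp add: power2_eq_square algebra_simps del: upt_Suc)
qed

lemma parts_simps [simp]: "mset (parts x) = x"
  by (simp add: parts_def)

lemma moves_wf:
  assumes "0 < N" "x \<in> partitions N"
  shows "pmf_of_list_wf (moves N x)"
proof (rule pmf_of_list_wfI)
  show "\<And>p. p \<in> set (map snd (moves N x)) \<Longrightarrow> p \<ge> 0"
    by (auto simp: moves_def Let_def)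
  define a where "a = parts x"
  have ma: "mset a = x" by (simp add: a_def)
  have pos: "0 < v" if "v \<in> set a" for v
    using that assms(2) ma by (auto simp: partitions_def)
  have "sum_list a = N"
    using assms(2) ma by (metis (mono_tags, lifting) mem_Collect_eq partitions_def sum_mset_sum_list)
  then have s: "(\<Sum>v\<leftarrow>a. real v) = real N"
    by (induction a arbitrary: N) auto
  have map_nth': "(\<Sum>i\<leftarrow>[0..<length a]. f (a ! i)) = (\<Sum>v\<leftarrow>a. f v)" for f :: "nat \<Rightarrow> real"
    by (metis (no_types, lifting) map_map map_nth o_def map_eq_conv)
  have concat_sum: "sum_list (concat (map g xs)) = (\<Sum>i\<leftarrow>xs. sum_list (g i))"
    for g :: "nat \<Rightarrow> real list" and xs
    by (induction xs) auto
  have split: "(\<Sum>i\<leftarrow>[0..<length a]. \<Sum>r\<leftarrow>[1..<a ! i]. real (a ! i) / real N ^ 2)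
      = ((\<Sum>v\<leftarrow>a. real v ^ 2) - real N) / real N ^ 2"
  proof -
    have "(\<Sum>i\<leftarrow>[0..<length a]. \<Sum>r\<leftarrow>[1..<a ! i]. real (a ! i) / real N ^ 2)
        = (\<Sum>v\<leftarrow>a. real (v - 1) * (real v / real N ^ 2))"
      by (subst map_nth'[symmetric]) (simp add: sum_list_triv)
    also have "\<dots> = (\<Sum>v\<leftarrow>a. (real v ^ 2 - real v) / real N ^ 2)"
    proof -
      have "real (v - 1) * (real v / real N ^ 2) = (real v ^ 2 - real v) / real N ^ 2"
        if "v \<in> set a" for v
        using pos[OF that] by (simp add: of_nat_diff power2_eq_square algebra_simps)
      then show ?thesis by (metis (mono_tags, lifting) map_eq_conv)
    qed
    also have "\<dots> = ((\<Sum>v\<leftarrow>a. real v ^ 2) - (\<Sum>v\<leftarrow>a. real v)) / real N ^ 2"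
      by (induction a) (auto simp: diff_divide_distrib add_divide_distrib)
    finally show ?thesis by (simp add: s)
  qed
  have merge: "(\<Sum>i\<leftarrow>[0..<length a]. \<Sum>j\<leftarrow>[Suc i..<length a].
                  2 * real (a ! i) * real (a ! j) / real N ^ 2)
      = (real N ^ 2 - (\<Sum>v\<leftarrow>a. real v ^ 2)) / real N ^ 2"
  proof -
    have "(\<Sum>i\<leftarrow>[0..<length a]. \<Sum>j\<leftarrow>[Suc i..<length a]. 2 * real (a ! i) * real (a ! j))
        = (\<Sum>i\<leftarrow>[0..<length (map real a)]. \<Sum>j\<leftarrow>[Suc i..<length (map real a)].
             2 * map real a ! i * map real a ! j)"
      by (intro arg_cong[where f = sum_list] map_cong refl) auto
    also have "\<dots> = real N ^ 2 - (\<Sum>v\<leftarrow>a. real v ^ 2)"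
      by (subst sum_list_pairs) (simp add: s o_def)
    finally show ?thesis
      by (simp add: divide_inverse sum_list_mult_const)
  qed
  have "sum_list (map snd (moves N x)) =
      (\<Sum>i\<leftarrow>[0..<length a]. \<Sum>r\<leftarrow>[1..<a ! i]. real (a ! i) / real N ^ 2) +
      (\<Sum>i\<leftarrow>[0..<length a]. \<Sum>j\<leftarrow>[Suc i..<length a].
          2 * real (a ! i) * real (a ! j) / real N ^ 2) + 1 / real N"
    by (simp add: moves_def Let_def a_def[symmetric] map_concat concat_sum o_def)
  also have "\<dots> = 1"
    unfolding split merge using assms(1) by (simp add: field_simps power2_eq_square)
  finally show "sum_list (map snd (moves N x)) = 1" .
qed

lemma split_or_merge_sym:
  assumes "split_or_merge x y"
    and "\<forall>a\<in>#x. 0 < a"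
  shows "split_or_merge y x"
  using assms(1) unfolding split_or_merge_def
proof (elim disjE exE conjE)
  fix a r assume *: "a \<in># x" "1 \<le> r" "r < a" "y = split_part x a r"
  then have "{#r, a - r#} \<subseteq># y" "x = merge_parts y r (a - r)"
    by (auto simp: split_part_def merge_parts_def)
  then show "(\<exists>a r. a \<in># y \<and> 1 \<le> r \<and> r < a \<and> x = split_part y a r) \<or>
     (\<exists>a b. {#a, b#} \<subseteq># y \<and> x = merge_parts y a b)" by blast
next
  fix a b assume *: "{#a, b#} \<subseteq># x" "y = merge_parts x a b"
  then obtain z where z: "x = {#a, b#} + z" by (auto simp: mset_subset_eq_exists_conv)
  have "a + b \<in># y \<and> 1 \<le> a \<and> a < a + b \<and> x = split_part y (a + b) a"
    using * z assms(2) by (auto simp: split_part_def merge_parts_def)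
  then show "(\<exists>a r. a \<in># y \<and> 1 \<le> r \<and> r < a \<and> x = split_part y a r) \<or>
     (\<exists>a b. {#a, b#} \<subseteq># y \<and> x = merge_parts y a b)" by blast
qed

lemma split_or_merge_partitions:
  assumes "split_or_merge x y" "x \<in> partitions N"
  shows "y \<in> partitions N"
  using assms(1) unfolding split_or_merge_def
proof (elim disjE exE conjE)
  fix a r assume "a \<in># x" "1 \<le> r" "r < a" "y = split_part x a r"
  then show ?thesis using assms(2)
    by (auto simp: partitions_def split_part_def sum_mset_diff dest: in_diffD dest!: multi_member_split)
next
  fix a b assume *: "{#a, b#} \<subseteq># x" "y = merge_parts x a b"
  then obtain z where "x = {#a, b#} + z" by (auto simp: mset_subset_eq_exists_conv)
  then show ?thesis using assms(2) * by (auto simp: partitions_def merge_parts_def)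
qed

lemma split_or_merge_to_ones:
  assumes "x \<in> partitions N"
  shows "split_or_merge\<^sup>*\<^sup>* x (replicate_mset N 1) \<and> split_or_merge\<^sup>*\<^sup>* (replicate_mset N 1) x"
  using assms
proof (induction "N - size x" arbitrary: x rule: less_induct)
  case less
  have size: "size y \<le> sum_mset y" if "\<forall>a\<in>#y. 0 < a" for y :: "nat multiset"
    using that by (induction y) (auto simp: Suc_le_eq)
  show ?case
  proof (cases "\<forall>a\<in>#x. a = 1")
    case True
    then have "x = replicate_mset (size x) 1"
      by (intro set_mset_subset_singletonD) auto
    moreover from this have "sum_mset x = size x"
      by (metis sum_mset_replicate_mset mult.right_neutral of_nat_id)
    ultimately show ?thesis using less.prems by (auto simp: partitions_def)
  next
    case False
    then obtain a where a: "a \<in># x" "a \<noteq> 1" by blast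
    with less.prems have "1 < a" by (auto simp: partitions_def)
    define y where "y = split_part x a 1"
    have xy: "split_or_merge x y"
      unfolding split_or_merge_def y_def using a \<open>1 < a\<close> by blast
    then have yx: "split_or_merge y x"
      using split_or_merge_sym less.prems by (auto simp: partitions_def)
    have y: "y \<in> partitions N" using xy less.prems by (rule split_or_merge_partitions)
    have "size y = Suc (size x)"
      using a by (auto simp: y_def split_part_def dest!: multi_member_split)
    moreover have "size y \<le> N" using y size[of y] by (auto simp: partitions_def)
    ultimately have "N - size y < N - size x" by simp
    from less.hyps[OF this y] show ?thesis
      using xy yx by (meson converse_rtranclp_into_rtranclp rtranclp.rtrancl_into_rtrancl)
  qed
qed

lemma split_or_merge_connected:
  assumes "x \<in> partitions N" "y \<in> partitions N"
  shows "\<exists>n. (split_or_merge ^^ n) x y"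
  using split_or_merge_to_ones[OF assms(1)] split_or_merge_to_ones[OF assms(2)]
  by (meson rtranclp_trans rtranclp_imp_relpowp)

end

theory Submission
  imports Defs
begin

text \<open>
  The walk is the image of the random transposition walk under cycle type. Running two partitions
  that differ by one merge, \<open>a, b\<close> against \<open>a + b\<close>, with the same transpositions keeps them at
  distance 1, and pairing lazy steps of one chain with suitable moves of the other one makes them
  meet with probability at least \<open>2 min(a, b) / N\<^sup>2\<close> in each step. This gives positivity. For the
  uniform bound, consider the Lyapunov function \<open>1/a + 1/b + m/(4N)\<close>, where \<open>m\<close> is the number of
  common parts. Its drift is at most \<open>(32 min(a, b) - N/4) / N\<^sup>2\<close>: the number of parts decreases at
  unit rate until large parts appear, and in the presence of large parts \<open>1/a + 1/b\<close> decreases at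
  rate of order \<open>1/N\<close> unless \<open>min(a, b)\<close> is of order \<open>N\<close>. Adding the constant 16, which is lost when the
  chains meet, cancels the term \<open>32 min(a, b)\<close>, so the cost, which lies in \<open>[16, 19]\<close>, contracts by the
  factor \<open>1 - 1/(76 N)\<close> per step. Couplings of neighbours are glued along paths for the general case.
\<close>

section \<open>The kernel as composition with a uniformly random transposition\<close>

text \<open>
  A list \<open>l\<close> of cycle lengths is laid out on the positions \<open>0, \<dots>, sum_list l - 1\<close>, one cycle after the
  other; \<open>move l u v\<close> is the cycle type after composing with the transposition of \<open>u\<close> and \<open>v\<close>.
\<close>

fun part_at :: "nat list \<Rightarrow> nat \<Rightarrow> nat" where
  "part_at [] w = 0"
| "part_at (c # cs) w = (if w < c then c else part_at cs (w - c))"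

fun move :: "nat list \<Rightarrow> nat \<Rightarrow> nat \<Rightarrow> nat multiset" where
  "move [] u v = {#}"
| "move (c # cs) u v =
     (if u < c \<and> v < c then
        (if u = v then {#c#} else {#(u - v) + (v - u), c - ((u - v) + (v - u))#}) + mset cs
      else if c \<le> u \<and> c \<le> v then add_mset c (move cs (u - c) (v - c))
      else let d = part_at cs (max u v - c) in add_mset (c + d) (mset cs - {#d#}))"

text \<open>For a partition of \<open>N\<close> this is \<open>N^2\<close> times the mean of
  \<open>F\<close> after one step. Merges run over ordered pairs of parts, which accounts for the
  factor 2 in \<open>moves\<close>.\<close>

definition total_weight :: "nat multiset \<Rightarrow> (nat multiset \<Rightarrow> real) \<Rightarrow> real" where
  "total_weight x F =
     (\<Sum>c\<in>#x. real c * (\<Sum>r = 1..<c. F (split_part x c r)))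
     + (\<Sum>c\<in>#x. \<Sum>d\<in>#x - {#c#}. real c * real d * F (merge_parts x c d))
     + real (sum_mset x) * F x"

text \<open>Peeling off one part gives a recursion that both descriptions of the walk satisfy. The
  factor 2 arises because \<open>c\<close> may come first or second in an ordered pair.\<close>

lemma total_weight_add_mset:
  "total_weight (add_mset c x) F =
     real c * (\<Sum>r = 1..<c. F (x + {#r, c - r#}))
     + 2 * (\<Sum>d\<in>#x. real c * real d * F (add_mset (c + d) (x - {#d#})))
     + real c * F (add_mset c x) + total_weight x (\<lambda>m. F (add_mset c m))"
proof -
  have split: "split_part (add_mset c x) d r = add_mset c (split_part x d r)" if "d \<in># x" for d r
    using that by (auto simp: split_part_def)
  have "(\<Sum>d\<in>#x. \<Sum>e\<in>#add_mset c x - {#d#}. real d * real e * F (merge_parts (add_mset c x) d e))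
     = (\<Sum>d\<in>#x. real c * real d * F (add_mset (c + d) (x - {#d#}))
        + (\<Sum>e\<in>#x - {#d#}. real d * real e * F (add_mset c (merge_parts x d e))))"
  proof (intro arg_cong[where f = sum_mset] image_mset_cong)
    fix d assume d: "d \<in># x"
    then have eq: "add_mset c x - {#d#} = add_mset c (x - {#d#})" by auto
    have m: "merge_parts (add_mset c x) d e = add_mset c (merge_parts x d e)" if "e \<in># x - {#d#}" for e
    proof -
      have "{#d, e#} \<subseteq># x"
        using that d by (metis insert_subset_eq_iff single_subset_iff)
      then obtain y where x: "x = {#d, e#} + y"
        by (auto simp: mset_subset_eq_exists_conv)
      have "add_mset c x - {#d, e#} = add_mset c (x - {#d, e#})"
        by (simp add: x multiset_eq_iff)
      then show ?thesis
        by (simp add: merge_parts_def)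
    qed
    have "add_mset c x - {#d, c#} = x - {#d#}"
      by (simp add: multiset_eq_iff)
    then have c: "merge_parts (add_mset c x) d c = add_mset (c + d) (x - {#d#})"
      by (simp add: merge_parts_def add.commute[of d c])
    show "(\<Sum>e\<in>#add_mset c x - {#d#}. real d * real e * F (merge_parts (add_mset c x) d e))
      = real c * real d * F (add_mset (c + d) (x - {#d#}))
        + (\<Sum>e\<in>#x - {#d#}. real d * real e * F (add_mset c (merge_parts x d e)))"
      unfolding eq by (simp add: c m cong: image_mset_cong)
  qed
  moreover have "(\<Sum>d\<in>#x. real c * real d * F (merge_parts (add_mset c x) c d))
     = (\<Sum>d\<in>#x. real c * real d * F (add_mset (c + d) (x - {#d#})))"
    by (simp add: merge_parts_def)
  moreover have "(\<Sum>d\<in>#x. real d * (\<Sum>r = 1..<d. F (split_part (add_mset c x) d r)))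
     = (\<Sum>d\<in>#x. real d * (\<Sum>r = 1..<d. F (add_mset c (split_part x d r))))"
    by (intro arg_cong[where f = sum_mset] image_mset_cong) (simp add: split)
  moreover have "split_part (add_mset c x) c r = x + {#r, c - r#}" for r
    by (simp add: split_part_def)
  ultimately show ?thesis
    by (simp add: total_weight_def sum_mset.distrib distrib_right)
qed

lemma sum_lessThan_add:
  fixes f :: "nat \<Rightarrow> 'a::comm_monoid_add"
  shows "(\<Sum>u<m + n. f u) = (\<Sum>u<m. f u) + (\<Sum>u<n. f (m + u))"
  using sum.atLeastLessThan_concat[of 0 m "m + n" f] sum.shift_bounds_nat_ivl[of f 0 m n]
  by (simp add: atLeast0LessThan add.commute)

text \<open>There are \<open>2 * (n - d)\<close> ordered pairs at distance \<open>d\<close> for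
  \<open>1 \<le> d < n\<close>. The induction adds the last row and column, in which each distance
  from 1 to \<open>n\<close> occurs twice.\<close>

lemma sum_square_dist:
  fixes h :: "nat \<Rightarrow> real"
  shows "(\<Sum>u<n. \<Sum>v<n. h ((u - v) + (v - u)))
    = real n * h 0 + (\<Sum>d = 1..<n. 2 * real (n - d) * h d)"
proof (induction n)
  case (Suc n)
  have row: "(\<Sum>u<n. h (n - u)) = (\<Sum>d = 1..<Suc n. h d)"
    by (rule sum.reindex_bij_witness[of _ "\<lambda>d. n - d" "\<lambda>u. n - u"]) auto
  have "(\<Sum>u<Suc n. \<Sum>v<Suc n. h ((u - v) + (v - u)))
     = (\<Sum>u<n. \<Sum>v<n. h ((u - v) + (v - u))) + 2 * (\<Sum>u<n. h (n - u)) + h 0"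
    by (simp add: sum.distrib)
  also have "\<dots> = real n * h 0 + (\<Sum>d = 1..<n. 2 * real (n - d) * h d)
      + 2 * (\<Sum>d = 1..<Suc n. h d) + h 0"
    by (simp only: Suc row)
  also have "real n * h 0 + (\<Sum>d = 1..<n. 2 * real (n - d) * h d)
      + 2 * (\<Sum>d = 1..<Suc n. h d) + h 0 = real (Suc n) * h 0 + (\<Sum>d = 1..<Suc n. 2 * real (Suc n - d) * h d)"
  proof -
    have "(\<Sum>d = 1..<n. 2 * real (n - d) * h d) = (\<Sum>d = 1..<Suc n. 2 * real (n - d) * h d)"
      by (cases n) simp_all
    moreover have "(\<Sum>d = 1..<Suc n. 2 * real (n - d) * h d) + 2 * (\<Sum>d = 1..<Suc n. h d)
        = (\<Sum>d = 1..<Suc n. 2 * real (Suc n - d) * h d)"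
      unfolding sum_distrib_left sum.distrib[symmetric]
      by (intro sum.cong refl) (auto simp: Suc_diff_le algebra_simps)
    ultimately show ?thesis by (simp add: algebra_simps)
  qed
  finally show ?case .
qed simp

lemma sum_part_at:
  fixes H :: "nat \<Rightarrow> real"
  shows "(\<Sum>w<sum_list l. H (part_at l w)) = (\<Sum>c\<in>#mset l. real c * H c)"
  by (induction l) (simp_all add: sum_lessThan_add)

text \<open>The square of positions falls into four blocks: both positions in the first cycle,
  exactly one in it (two mirror blocks, hence the factor 2), or none. A pair at distance
  \<open>d\<close> within the first cycle cuts it into \<open>d\<close> and
  \<open>c - d\<close>.\<close>

lemma sum_move_Cons:
  fixes F :: "nat multiset \<Rightarrow> real"
  shows "(\<Sum>u<sum_list (c # cs). \<Sum>v<sum_list (c # cs). F (move (c # cs) u v)) =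
     real c * F (add_mset c (mset cs))
     + (\<Sum>d = 1..<c. 2 * real (c - d) * F ({#d, c - d#} + mset cs))
     + 2 * (\<Sum>d\<in>#mset cs. real c * real d * F (add_mset (c + d) (mset cs - {#d#})))
     + (\<Sum>u<sum_list cs. \<Sum>v<sum_list cs. F (add_mset c (move cs u v)))"
proof -
  have 1: "(\<Sum>u<c. \<Sum>v<c. F (move (c # cs) u v)) = real c * F (add_mset c (mset cs))
     + (\<Sum>d = 1..<c. 2 * real (c - d) * F ({#d, c - d#} + mset cs))"
  proof -
    define h where "h d = F ((if d = 0 then {#c#} else {#d, c - d#}) + mset cs)" for d
    have "(\<Sum>u<c. \<Sum>v<c. F (move (c # cs) u v)) = (\<Sum>u<c. \<Sum>v<c. h ((u - v) + (v - u)))"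
      by (intro sum.cong refl) (auto simp: h_def)
    then show ?thesis unfolding sum_square_dist by (simp add: h_def cong: sum.cong_simp)
  qed
  have 2: "(\<Sum>w<sum_list cs. F (add_mset (c + part_at cs w) (mset cs - {#part_at cs w#})))
     = (\<Sum>d\<in>#mset cs. real d * F (add_mset (c + d) (mset cs - {#d#})))"
    by (rule sum_part_at)
  have 3: "(\<Sum>d\<in>#mset cs. real c * real d * F (add_mset (c + d) (mset cs - {#d#})))
     = real c * (\<Sum>d\<in>#mset cs. real d * F (add_mset (c + d) (mset cs - {#d#})))"
    by (simp add: sum_mset_distrib_left mult.assoc)
  have "(\<Sum>u<sum_list cs. \<Sum>v<c. F (move (c # cs) (c + u) v))
     = real c * (\<Sum>d\<in>#mset cs. real d * F (add_mset (c + d) (mset cs - {#d#})))"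
    by (subst sum.swap) (simp add: Let_def 2)
  moreover have "(\<Sum>u<c. \<Sum>v<sum_list cs. F (move (c # cs) u (c + v)))
     = real c * (\<Sum>d\<in>#mset cs. real d * F (add_mset (c + d) (mset cs - {#d#})))"
    by (simp add: Let_def 2)
  moreover have "(\<Sum>u<sum_list (c # cs). \<Sum>v<sum_list (c # cs). F (move (c # cs) u v))
     = (\<Sum>u<c. \<Sum>v<c. F (move (c # cs) u v))
       + (\<Sum>u<c. \<Sum>v<sum_list cs. F (move (c # cs) u (c + v)))
       + (\<Sum>u<sum_list cs. \<Sum>v<c. F (move (c # cs) (c + u) v))
       + (\<Sum>u<sum_list cs. \<Sum>v<sum_list cs. F (move (c # cs) (c + u) (c + v)))"
    by (simp add: sum_lessThan_add sum.distrib del: move.simps)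
  ultimately show ?thesis
    unfolding 1 3 by simp
qed

lemma sum_move:
  fixes F :: "nat multiset \<Rightarrow> real"
  shows "(\<Sum>u<sum_list l. \<Sum>v<sum_list l. F (move l u v)) = total_weight (mset l) F"
proof (induction l arbitrary: F)
  case Nil
  show ?case by (simp add: total_weight_def)
next
  case (Cons c cs)
  define G where "G d = F (mset cs + {#d, c - d#})" for d
  \<comment> \<open>Cutting at \<open>d\<close> or at \<open>c - d\<close> gives the same partition.
    Averaging the two weights replaces \<open>2 * (c - d)\<close> by the constant \<open>c\<close>,
    the split rate of the walk.\<close>
  have "(\<Sum>d = 1..<c. real (c - d) * G d) = (\<Sum>d = 1..<c. real d * G d)"
    by (rule sum.reindex_bij_witness[of _ "\<lambda>d. c - d" "\<lambda>d. c - d"])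
      (auto simp: G_def add_mset_commute)
  then have "(\<Sum>d = 1..<c. 2 * real (c - d) * G d)
      = (\<Sum>d = 1..<c. real (c - d) * G d) + (\<Sum>d = 1..<c. real d * G d)"
    unfolding sum_distrib_left mult.assoc by (simp add: mult.assoc flip: sum_distrib_left)
  also have "\<dots> = real c * (\<Sum>d = 1..<c. G d)"
    unfolding sum_distrib_left sum.distrib[symmetric]
    by (intro sum.cong refl) (auto simp: of_nat_diff algebra_simps)
  finally show ?case
    unfolding sum_move_Cons Cons.IH[of "\<lambda>m. F (add_mset c m)"] mset.simps total_weight_add_mset
    by (simp add: G_def add.commute)
qed

text \<open>The list \<open>l\<close> may be in any order. Removing its head splits off exactly the
  terms of \<open>total_weight_add_mset\<close>; each pair \<open>i < j\<close> carries the weight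
  of both ordered pairs.\<close>

lemma sum_list_moves:
  fixes F :: "nat multiset \<Rightarrow> real"
  shows "(\<Sum>i\<leftarrow>[0..<length l]. \<Sum>r\<leftarrow>[1..<l ! i]. real (l ! i) * F (split_part (mset l) (l ! i) r))
     + (\<Sum>i\<leftarrow>[0..<length l]. \<Sum>j\<leftarrow>[Suc i..<length l].
          2 * real (l ! i) * real (l ! j) * F (merge_parts (mset l) (l ! i) (l ! j)))
     + real (sum_list l) * F (mset l) = total_weight (mset l) F"
proof (induction l arbitrary: F)
  case Nil
  show ?case by (simp add: total_weight_def)
next
  case (Cons c cs)
  let ?G = "\<lambda>m. F (add_mset c m)"
  have upt: "[0..<length (c # cs)] = 0 # map Suc [0..<length cs]"
    by (simp add: upt_conv_Cons map_Suc_upt del: upt_Suc)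
  have map_nth': "(\<Sum>i\<leftarrow>[0..<length cs]. f (cs ! i)) = (\<Sum>d\<in>#mset cs. f d)" for f :: "nat \<Rightarrow> real"
  proof -
    have "map (\<lambda>i. f (cs ! i)) [0..<length cs] = map f cs"
      by (rule nth_equalityI) auto
    then show ?thesis by (metis mset_map sum_mset_sum_list)
  qed
  have split: "(\<Sum>i\<leftarrow>[0..<length cs]. \<Sum>r\<leftarrow>[1..<cs ! i].
        real (cs ! i) * F (split_part (add_mset c (mset cs)) (cs ! i) r))
     = (\<Sum>i\<leftarrow>[0..<length cs]. \<Sum>r\<leftarrow>[1..<cs ! i]. real (cs ! i) * ?G (split_part (mset cs) (cs ! i) r))"
  proof (intro arg_cong[where f = sum_list] map_cong refl)
    fix i r assume "i \<in> set [0..<length cs]"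
    then have "cs ! i \<in># mset cs" by auto
    then have "split_part (add_mset c (mset cs)) (cs ! i) r = add_mset c (split_part (mset cs) (cs ! i) r)"
      by (auto simp: split_part_def)
    then show "real (cs ! i) * F (split_part (add_mset c (mset cs)) (cs ! i) r)
       = real (cs ! i) * ?G (split_part (mset cs) (cs ! i) r)" by simp
  qed
  have merge: "(\<Sum>i\<leftarrow>[0..<length cs]. \<Sum>j\<leftarrow>[Suc i..<length cs].
        2 * real (cs ! i) * real (cs ! j) * F (merge_parts (add_mset c (mset cs)) (cs ! i) (cs ! j)))
     = (\<Sum>i\<leftarrow>[0..<length cs]. \<Sum>j\<leftarrow>[Suc i..<length cs].
        2 * real (cs ! i) * real (cs ! j) * ?G (merge_parts (mset cs) (cs ! i) (cs ! j)))"
  proof (intro arg_cong[where f = sum_list] map_cong refl)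
    fix i j assume "i \<in> set [0..<length cs]" "j \<in> set [Suc i..<length cs]"
    then have ij: "i < j" "j < length cs" by auto
    \<comment> \<open>Cutting the list before position \<open>j\<close> shows that the two entries
      occur separately, even if their values agree.\<close>
    have "mset cs = mset (take j cs) + mset (drop j cs)"
      by (metis append_take_drop_id mset_append)
    moreover have "cs ! i \<in># mset (take j cs)"
      using ij by (auto simp: in_set_conv_nth intro!: exI[of _ i])
    moreover have "cs ! j \<in># mset (drop j cs)"
      using ij by (simp flip: Cons_nth_drop_Suc)
    ultimately obtain y1 y2 where "mset cs = add_mset (cs ! i) y1 + add_mset (cs ! j) y2"
      by (metis multi_member_split)
    then have y: "mset cs = {#cs ! i, cs ! j#} + (y1 + y2)" by simp
    have "add_mset c (mset cs) - {#cs ! i, cs ! j#} = add_mset c (mset cs - {#cs ! i, cs ! j#})"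
      by (simp add: y multiset_eq_iff)
    then have "merge_parts (add_mset c (mset cs)) (cs ! i) (cs ! j)
        = add_mset c (merge_parts (mset cs) (cs ! i) (cs ! j))"
      by (simp add: merge_parts_def)
    then show "2 * real (cs ! i) * real (cs ! j) * F (merge_parts (add_mset c (mset cs)) (cs ! i) (cs ! j))
       = 2 * real (cs ! i) * real (cs ! j) * ?G (merge_parts (mset cs) (cs ! i) (cs ! j))" by simp
  qed
  have first: "(\<Sum>j\<leftarrow>[Suc 0..<Suc (length cs)].
        2 * real c * real ((c # cs) ! j) * F (merge_parts (add_mset c (mset cs)) c ((c # cs) ! j)))
     = 2 * (\<Sum>d\<in>#mset cs. real c * real d * F (add_mset (c + d) (mset cs - {#d#})))"
    using map_nth'[of "\<lambda>d. 2 * real c * real d * F (add_mset (c + d) (mset cs - {#d#}))"]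
    by (simp add: map_Suc_upt[symmetric] o_def merge_parts_def sum_mset_distrib_left mult.assoc
        del: upt_Suc)
  have first_split: "(\<Sum>r\<leftarrow>[1..<c]. real c * F (split_part (add_mset c (mset cs)) c r))
     = real c * (\<Sum>r = 1..<c. F (mset cs + {#r, c - r#}))"
    by (simp add: split_part_def sum_distrib_left sum_list_distinct_conv_sum_set)
  have Suc_upt: "[Suc (Suc i)..<Suc n] = map Suc [Suc i..<n]" for i n
    by (simp only: map_Suc_upt)
  show ?case
    unfolding upt mset.simps total_weight_add_mset Cons.IH[of ?G, symmetric]
      split[symmetric] merge[symmetric]
    using first first_split
    by (simp add: o_def Suc_upt distrib_right del: upt_Suc)
qed

text \<open>Under both laws the mean of \<open>F\<close> is
  \<open>total_weight (mset l) F / N^2\<close>; here \<open>F\<close> is the indicator of a point.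
  Any ordering \<open>l\<close> of the parts may serve, which later allows a layout adapted to a
  pair of partitions.\<close>

lemma split_merge_kernel_eq:
  assumes "0 < N" "mset l \<in> partitions N"
  shows "split_merge_kernel N (mset l)
    = map_pmf (\<lambda>(u, v). move l u v) (pmf_of_set ({..<N} \<times> {..<N}))"
proof (rule pmf_eqI)
  fix y
  define F :: "nat multiset \<Rightarrow> real" where "F m = of_bool (m = y)" for m
  define a where "a = parts (mset l)"
  have ma: "mset a = mset l" by (simp add: a_def)
  have sum: "sum_list l = N" "sum_list a = N"
    using assms(2) ma by (auto simp: partitions_def simp flip: sum_mset_sum_list)
  have filter: "sum_list (map snd (filter (\<lambda>z. fst z = y) zs)) = (\<Sum>z\<leftarrow>zs. snd z * F (fst z))" for zs
    by (induction zs) (auto simp: F_def)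
  have concat_sum: "sum_list (concat (map g xs)) = (\<Sum>i\<leftarrow>xs. sum_list (g i))"
    for g :: "nat \<Rightarrow> real list" and xs
    by (induction xs) auto
  have "pmf (split_merge_kernel N (mset l)) y = (\<Sum>z\<leftarrow>moves N (mset l). snd z * F (fst z))"
    unfolding split_merge_kernel_def using moves_wf[OF assms] filter by (simp add: pmf_pmf_of_list)
  also have "\<dots> = (\<Sum>i\<leftarrow>[0..<length a]. \<Sum>r\<leftarrow>[1..<a ! i].
          real (a ! i) / real N ^ 2 * F (split_part (mset l) (a ! i) r))
     + (\<Sum>i\<leftarrow>[0..<length a]. \<Sum>j\<leftarrow>[Suc i..<length a].
          2 * real (a ! i) * real (a ! j) / real N ^ 2 * F (merge_parts (mset l) (a ! i) (a ! j)))
     + 1 / real N * F (mset l)"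
    by (simp add: moves_def Let_def a_def[symmetric] map_concat concat_sum o_def)
  also have "\<dots> = total_weight (mset l) F / real N ^ 2"
  proof -
    have weight: "c / real N ^ 2 * r = inverse (real N ^ 2) * (c * r)" for c r :: real
      by (simp add: divide_inverse)
    have total: "inverse (real N ^ 2) * A + inverse (real N ^ 2) * B + 1 / real N * r
        = (A + B + real N * r) / real N ^ 2" for A B r
      using assms(1) by (simp add: field_simps power2_eq_square)
    show ?thesis
      unfolding sum_list_moves[of a F, unfolded ma sum(2), symmetric]
      by (simp only: weight sum_list_const_mult total)
  qed
  also have "\<dots> = (\<Sum>(u, v)\<in>{..<N} \<times> {..<N}. F (move l u v)) / real N ^ 2"
    unfolding sum_move[symmetric] sum(1) by (simp add: sum.cartesian_product)
  also have "\<dots> = pmf (map_pmf (\<lambda>(u, v). move l u v) (pmf_of_set ({..<N} \<times> {..<N}))) y"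
  proof -
    have "(\<Sum>(u, v)\<in>{..<N} \<times> {..<N}. F (move l u v))
       = real (card (({..<N} \<times> {..<N}) \<inter> (\<lambda>(u, v). move l u v) -` {y}))"
      by (simp add: F_def sum_of_bool_eq case_prod_unfold vimage_def)
    moreover have "{..<N} \<times> {..<N} \<noteq> {}" using assms(1) by auto
    ultimately show ?thesis
      by (simp add: pmf_map measure_pmf_of_set power2_eq_square)
  qed
  finally show "pmf (split_merge_kernel N (mset l)) y = \<dots>" .
qed

section \<open>Iterating and gluing couplings\<close>

text \<open>Choosing a one-step coupling for each pair in \<open>G\<close> gives a Markov chain of
  pairs that never leaves \<open>G\<close>, so a factor \<rho> is gained at each step. Finite
  supports turn the expectations into finite sums.\<close>

lemma iterate_coupling:
  fixes P :: "'a \<Rightarrow> 'a pmf" and \<phi> :: "'a \<times> 'a \<Rightarrow> real"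
  assumes step: "\<And>p. p \<in> G \<Longrightarrow> \<exists>\<pi>\<in>couplings (P (fst p)) (P (snd p)).
      finite (set_pmf \<pi>) \<and> set_pmf \<pi> \<subseteq> G \<and> measure_pmf.expectation \<pi> \<phi> \<le> \<rho> * \<phi> p"
    and "0 \<le> \<rho>" "(x, y) \<in> G"
  shows "\<exists>\<pi>\<in>couplings (iterate_kernel P k x) (iterate_kernel P k y).
      finite (set_pmf \<pi>) \<and> set_pmf \<pi> \<subseteq> G \<and> measure_pmf.expectation \<pi> \<phi> \<le> \<rho> ^ k * \<phi> (x, y)"
proof (induction k)
  case 0
  show ?case
    using assms(3) by (intro bexI[of _ "return_pmf (x, y)"]) (auto simp: couplings_def)
next
  case (Suc k)
  then obtain \<pi> where \<pi>: "\<pi> \<in> couplings (iterate_kernel P k x) (iterate_kernel P k y)"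
    "finite (set_pmf \<pi>)" "set_pmf \<pi> \<subseteq> G" "measure_pmf.expectation \<pi> \<phi> \<le> \<rho> ^ k * \<phi> (x, y)"
    by blast
  obtain K where K: "\<And>p. p \<in> G \<Longrightarrow> K p \<in> couplings (P (fst p)) (P (snd p))"
    "\<And>p. p \<in> G \<Longrightarrow> finite (set_pmf (K p))" "\<And>p. p \<in> G \<Longrightarrow> set_pmf (K p) \<subseteq> G"
    "\<And>p. p \<in> G \<Longrightarrow> measure_pmf.expectation (K p) \<phi> \<le> \<rho> * \<phi> p"
    using step by metis
  have "measure_pmf.expectation (bind_pmf \<pi> K) \<phi>
      = (\<Sum>p\<in>set_pmf \<pi>. pmf \<pi> p *\<^sub>R measure_pmf.expectation (K p) \<phi>)"
    using \<pi>(2,3) K(2) by (intro pmf_expectation_bind) auto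
  also have "\<dots> \<le> (\<Sum>p\<in>set_pmf \<pi>. pmf \<pi> p *\<^sub>R (\<rho> * \<phi> p))"
    using \<pi>(3) K(4) by (intro sum_mono scaleR_left_mono) auto
  also have "\<dots> = \<rho> * measure_pmf.expectation \<pi> \<phi>"
    using \<pi>(2) by (subst integral_measure_pmf[of "set_pmf \<pi>"]) (auto simp: sum_distrib_left mult_ac)
  also have "\<dots> \<le> \<rho> ^ Suc k * \<phi> (x, y)"
    using mult_left_mono[OF \<pi>(4) assms(2)] by (simp add: mult.assoc)
  finally have E: "measure_pmf.expectation (bind_pmf \<pi> K) \<phi> \<le> \<rho> ^ Suc k * \<phi> (x, y)" .
  have fst: "map_pmf fst (bind_pmf \<pi> K) = bind_pmf (map_pmf fst \<pi>) P"
    unfolding map_bind_pmf bind_map_pmf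
    using \<pi>(3) K(1) by (intro bind_pmf_cong refl) (auto simp: couplings_def)
  have snd: "map_pmf snd (bind_pmf \<pi> K) = bind_pmf (map_pmf snd \<pi>) P"
    unfolding map_bind_pmf bind_map_pmf
    using \<pi>(3) K(1) by (intro bind_pmf_cong refl) (auto simp: couplings_def)
  have "bind_pmf \<pi> K \<in> couplings (iterate_kernel P (Suc k) x) (iterate_kernel P (Suc k) y)"
    using fst snd \<pi>(1) by (simp add: couplings_def)
  moreover have "finite (set_pmf (bind_pmf \<pi> K))"
    using \<pi>(2,3) K(2) by auto
  moreover have "set_pmf (bind_pmf \<pi> K) \<subseteq> G"
    using \<pi>(3) K(3) unfolding set_bind_pmf by blast
  ultimately show ?case using E by blast
qed

text \<open>This is the gluing lemma: given the middle state, the two outer states are drawn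
  independently, and the triangle inequality is integrated over the resulting law.\<close>

lemma glue_couplings:
  fixes d :: "'a \<Rightarrow> 'a \<Rightarrow> real"
  assumes \<pi>: "\<pi> \<in> couplings \<mu> \<nu>" "finite (set_pmf \<pi>)" "set_pmf \<pi> \<subseteq> S \<times> S"
    and \<pi>': "\<pi>' \<in> couplings \<nu> \<xi>" "finite (set_pmf \<pi>')" "set_pmf \<pi>' \<subseteq> S \<times> S"
    and triangle: "\<And>x y z. x \<in> S \<Longrightarrow> y \<in> S \<Longrightarrow> z \<in> S \<Longrightarrow> d x z \<le> d x y + d y z"
  shows "\<exists>\<sigma>\<in>couplings \<mu> \<xi>. finite (set_pmf \<sigma>) \<and> set_pmf \<sigma> \<subseteq> S \<times> S \<and>
    measure_pmf.expectation \<sigma> (\<lambda>(x, y). d x y) \<le>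
    measure_pmf.expectation \<pi> (\<lambda>(x, y). d x y) + measure_pmf.expectation \<pi>' (\<lambda>(x, y). d x y)"
proof -
  define cond where "cond p = cond_pmf \<pi>' {q. snd p = fst q}" for p :: "'a \<times> 'a"
  define \<tau> where "\<tau> = bind_pmf \<pi> (\<lambda>p. map_pmf (Pair p) (cond p))"
  have \<nu>: "map_pmf snd \<pi> = \<nu>" "map_pmf fst \<pi>' = \<nu>"
    using \<pi>(1) \<pi>'(1) by (auto simp: couplings_def)
  have ne: "set_pmf \<pi>' \<inter> {q. snd p = fst q} \<noteq> {}" if "p \<in> set_pmf \<pi>" for p
  proof -
    have "snd p \<in> fst ` set_pmf \<pi>'" using that \<nu> by (metis imageI set_map_pmf)
    then show ?thesis by auto
  qed
  have ne': "set_pmf \<pi> \<inter> {p. snd p = fst q} \<noteq> {}" if "q \<in> set_pmf \<pi>'" for q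
  proof -
    have "fst q \<in> snd ` set_pmf \<pi>" using that \<nu> by (metis imageI set_map_pmf)
    then show ?thesis by force
  qed
  have fst: "map_pmf fst \<tau> = \<pi>"
    by (simp add: \<tau>_def map_bind_pmf map_pmf_comp map_pmf_const bind_return_pmf')
  \<comment> \<open>Conditioning disintegrates \<open>\<pi>'\<close> because the events
    \<open>snd p = fst q\<close>, seen under \<open>\<pi>'\<close> and under \<open>\<pi>\<close>,
    both have the mass that \<nu> gives to the middle state.\<close>
  have "bind_pmf \<pi> cond = \<pi>'"
    unfolding cond_def
  proof (rule bind_cond_pmf_cancel)
    fix p q :: "'a \<times> 'a" assume eq: "snd p = fst q"
    have "measure_pmf.prob \<pi>' {q'. snd p = fst q'} = measure_pmf.prob (map_pmf fst \<pi>') {snd p}"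
      by (simp add: measure_map_pmf vimage_def eq_commute)
    also have "\<dots> = measure_pmf.prob (map_pmf snd \<pi>) {fst q}"
      by (simp add: \<nu> eq)
    also have "\<dots> = measure_pmf.prob \<pi> {p'. snd p' = fst q}"
      by (simp add: measure_map_pmf vimage_def)
    finally show "measure_pmf.prob \<pi>' {q'. snd p = fst q'} = measure_pmf.prob \<pi> {p'. snd p' = fst q}" .
  qed (use ne ne' in auto)
  then have snd: "map_pmf snd \<tau> = \<pi>'"
    by (simp add: \<tau>_def map_bind_pmf map_pmf_comp)
  have set: "set_pmf \<tau> \<subseteq> {(p, q). p \<in> set_pmf \<pi> \<and> q \<in> set_pmf \<pi>' \<and> snd p = fst q}"
    using ne by (auto simp: \<tau>_def cond_def)
  then have fin: "finite (set_pmf \<tau>)"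
    using \<pi>(2) \<pi>'(2) by (auto intro: finite_subset[of _ "set_pmf \<pi> \<times> set_pmf \<pi>'"])
  define \<sigma> where "\<sigma> = map_pmf (\<lambda>(p, q). (fst p, snd q)) \<tau>"
  have "measure_pmf.expectation \<sigma> (\<lambda>(x, y). d x y)
     = measure_pmf.expectation \<tau> (\<lambda>(p, q). d (fst p) (snd q))"
    by (simp add: \<sigma>_def case_prod_unfold)
  also have "\<dots> \<le> measure_pmf.expectation \<tau>
      (\<lambda>t. d (fst (fst t)) (snd (fst t)) + d (fst (snd t)) (snd (snd t)))"
  proof (rule integral_mono_AE)
    show "AE t in measure_pmf \<tau>. (case t of (p, q) \<Rightarrow> d (fst p) (snd q))
        \<le> d (fst (fst t)) (snd (fst t)) + d (fst (snd t)) (snd (snd t))"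
    proof (rule AE_pmfI)
      fix t assume "t \<in> set_pmf \<tau>"
      then have "fst t \<in> set_pmf \<pi>" "snd t \<in> set_pmf \<pi>'" "snd (fst t) = fst (snd t)"
        using set by auto
      then show "(case t of (p, q) \<Rightarrow> d (fst p) (snd q))
          \<le> d (fst (fst t)) (snd (fst t)) + d (fst (snd t)) (snd (snd t))"
        using triangle[of "fst (fst t)" "snd (fst t)" "snd (snd t)"] \<pi>(3) \<pi>'(3)
        by (auto simp: case_prod_unfold mem_Times_iff dest!: subsetD)
    qed
  qed (auto intro!: integrable_measure_pmf_finite fin)
  also have "\<dots> = measure_pmf.expectation (map_pmf fst \<tau>) (\<lambda>(x, y). d x y)
      + measure_pmf.expectation (map_pmf snd \<tau>) (\<lambda>(x, y). d x y)"
    using fin by (simp add: integrable_measure_pmf_finite case_prod_unfold)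
  finally have E: "measure_pmf.expectation \<sigma> (\<lambda>(x, y). d x y)
    \<le> measure_pmf.expectation \<pi> (\<lambda>(x, y). d x y) + measure_pmf.expectation \<pi>' (\<lambda>(x, y). d x y)"
    by (simp only: fst snd)
  have "map_pmf fst \<sigma> = map_pmf fst (map_pmf fst \<tau>)" "map_pmf snd \<sigma> = map_pmf snd (map_pmf snd \<tau>)"
    by (simp_all add: \<sigma>_def map_pmf_comp case_prod_unfold)
  then have "\<sigma> \<in> couplings \<mu> \<xi>"
    using \<pi>(1) \<pi>'(1) by (simp add: fst snd couplings_def)
  moreover have "finite (set_pmf \<sigma>)" using fin by (simp add: \<sigma>_def)
  moreover have "set_pmf \<sigma> \<subseteq> S \<times> S"
    using set \<pi>(3) \<pi>'(3) by (force simp: \<sigma>_def)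
  ultimately show ?thesis using E by blast
qed

section \<open>Basic properties of \<open>move\<close> and the drift of the number of parts\<close>

lemma move_commute: "move l u v = move l v u"
  by (induction l u v rule: move.induct) (auto simp: Let_def add.commute max.commute)

lemma part_at_in_set: "w < sum_list l \<Longrightarrow> part_at l w \<in> set l"
  by (induction l w rule: part_at.induct) auto

lemma move_same: "w < sum_list l \<Longrightarrow> move l w w = mset l"
  by (induction l arbitrary: w) auto

lemma move_in_partitions:
  assumes "mset l \<in> partitions N" "u < N" "v < N"
  shows "move l u v \<in> partitions N"
proof -
  have "(\<forall>c\<in>#move l u v. 0 < c) \<and> sum_mset (move l u v) = sum_list l"
    if "\<forall>c\<in>set l. 0 < c" "u < sum_list l" "v < sum_list l"
    using that
  proof (induction l u v rule: move.induct)
    case (2 c cs u v)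
    have merge: "(\<forall>e\<in>#add_mset (c + d) (mset cs - {#d#}). 0 < e)
        \<and> sum_mset (add_mset (c + d) (mset cs - {#d#})) = c + sum_list cs" if "d \<in> set cs" for d
    proof -
      from that obtain y where "mset cs = add_mset d y" by (metis multi_member_split set_mset_mset)
      moreover from this have "sum_list cs = d + sum_mset y"
        by (metis sum_mset.add_mset sum_mset_sum_list)
      moreover have "\<forall>e\<in>#mset cs. 0 < e" using "2.prems"(1) by simp
      ultimately show ?thesis using "2.prems"(1) by auto
    qed
    consider "u < c \<and> v < c" | "c \<le> u \<and> c \<le> v" | "\<not> (u < c \<and> v < c)" "\<not> (c \<le> u \<and> c \<le> v)"
      by blast
    then show ?case
    proof cases
      case 1
      then show ?thesis using "2.prems" by (auto simp: sum_mset_sum_list)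
    next
      case 2
      then show ?thesis using "2.prems" "2.IH" by auto
    next
      case 3
      then have "part_at cs (max u v - c) \<in> set cs"
        using "2.prems" by (intro part_at_in_set) (auto simp: max_def)
      moreover have "move (c # cs) u v = add_mset (c + part_at cs (max u v - c))
          (mset cs - {#part_at cs (max u v - c)#})"
        using 3 by (auto simp: Let_def)
      ultimately show ?thesis using merge by simp
    qed
  qed simp
  then show ?thesis
    using assms by (auto simp: partitions_def sum_mset_sum_list)
qed

lemma sum_dist: "(\<Sum>d = 1..<n. 2 * real (n - d)) = real n * (real n - 1)"
  using sum_square_dist[of "\<lambda>_. 1" n] by (simp add: algebra_simps)

text \<open>A transposition within a cycle adds a part, and one between two cycles removes a part.
  With \<open>N\<close> the sum and \<open>Q\<close> the sum of squares of \<open>l\<close>, there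
  are \<open>Q - N\<close> ordered pairs of the first kind and \<open>N^2 - Q\<close> of the
  second.\<close>

lemma sum_size_move:
  "(\<Sum>u<sum_list l. \<Sum>v<sum_list l. real (size (move l u v)))
     = real (sum_list l) ^ 2 * real (length l)
       + 2 * (\<Sum>c\<leftarrow>l. real c ^ 2) - real (sum_list l) - real (sum_list l) ^ 2"
proof (induction l)
  case (Cons c cs)
  let ?m = "real (length cs)" and ?Z = "real (sum_list cs)"
  have "(\<Sum>d = 1..<c. 2 * real (c - d) * real (size ({#d, c - d#} + mset cs)))
      = real c * (real c - 1) * (?m + 2)"
    unfolding sum_dist[symmetric] sum_distrib_right by (intro sum.cong refl) simp
  moreover have "(\<Sum>d\<in>#mset cs. real c * real d * real (size (add_mset (c + d) (mset cs - {#d#}))))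
      = real c * ?Z * ?m"
  proof -
    have "(\<Sum>d\<in>#mset cs. real c * real d * real (size (add_mset (c + d) (mset cs - {#d#}))))
        = (\<Sum>d\<in>#mset cs. real c * real d * ?m)"
      by (intro arg_cong[where f = sum_mset] image_mset_cong)
        (metis insert_DiffM size_add_mset size_mset)
    also have "\<dots> = real c * (\<Sum>d\<in>#mset cs. real d) * ?m"
      by (simp add: sum_mset_distrib_left sum_mset_distrib_right)
    also have "(\<Sum>d\<in>#mset cs. real d) = ?Z"
      by (induction cs) auto
    finally show ?thesis .
  qed
  moreover have "(\<Sum>u<sum_list cs. \<Sum>v<sum_list cs. real (size (add_mset c (move cs u v))))
      = ?Z ^ 2 + (\<Sum>u<sum_list cs. \<Sum>v<sum_list cs. real (size (move cs u v)))"
    by (simp add: sum.distrib power2_eq_square)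
  ultimately show ?case
    unfolding sum_move_Cons[where F = "\<lambda>m. real (size m)"] Cons.IH by (simp add: power2_eq_square algebra_simps)
qed simp

section \<open>Partitions that differ by one merge, under a common transposition\<close>

text \<open>
  For the cycle lists \<open>(a + b) # zs\<close> and \<open>a # b # zs\<close>, the same transposition leads again to two
  partitions that differ in one merge: two parts \<open>a', b'\<close> against their sum. Which of the two
  partitions is the merged one may change.
\<close>

definition tagged :: "nat \<Rightarrow> nat \<Rightarrow> nat list \<Rightarrow> nat \<Rightarrow> nat \<Rightarrow> nat \<times> nat \<times> nat multiset" where
  "tagged a b zs u v =
     (let d = (u - v) + (v - u); c = part_at zs (max u v - (a + b)) in
      if u = v then (a, b, mset zs)
      else if max u v < a then (a - d, b, add_mset d (mset zs))
      else if a \<le> min u v \<and> max u v < a + b then (a, b - d, add_mset d (mset zs))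
      else if max u v < a + b then (d, a + b - d, mset zs)
      else if a + b \<le> min u v then (a, b, move zs (u - (a + b)) (v - (a + b)))
      else if min u v < a then (a + c, b, mset zs - {#c#})
      else (a, b + c, mset zs - {#c#}))"

definition merge_pair :: "nat \<times> nat \<times> nat multiset \<Rightarrow> nat multiset \<Rightarrow> nat multiset \<Rightarrow> bool" where
  "merge_pair t x y \<longleftrightarrow> (case t of (a, b, z) \<Rightarrow>
     0 < a \<and> 0 < b \<and> (x = add_mset (a + b) z \<and> y = {#a, b#} + z \<or> y = add_mset (a + b) z \<and> x = {#a, b#} + z))"

lemma tagged_commute: "tagged a b zs u v = tagged a b zs v u"
  unfolding tagged_def Let_def
  by (simp only: max.commute[of u v] min.commute[of u v] add.commute[of "u - v" "v - u"]
      eq_commute[of u v] move_commute[of zs "u - (a + b)" "v - (a + b)"])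

lemma move_merge_pair:
  assumes "0 < a" "0 < b" "u < a + b + sum_list zs" "v < a + b + sum_list zs"
  shows "merge_pair (tagged a b zs u v) (move ((a + b) # zs) u v) (move (a # b # zs) u v)"
proof -
  have main: "merge_pair (tagged a b zs u v) (move ((a + b) # zs) u v) (move (a # b # zs) u v)"
    if uv: "u < v" "v < a + b + sum_list zs" for u v
  proof -
    \<comment> \<open>If both positions lie in the same short cycle, the piece cut off becomes a
      common part. Only the third case, with one position in each short cycle, exchanges the roles:
      the long cycle splits while \<open>a\<close> and \<open>b\<close> merge.\<close>
    consider "v < a" | "a \<le> u" "v < a + b" | "u < a" "a \<le> v" "v < a + b" | "a + b \<le> u"
      | "u < a" "a + b \<le> v" | "a \<le> u" "u < a + b" "a + b \<le> v"
      using uv by linarith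
    then show ?thesis
    proof cases
      case 1
      then show ?thesis using uv assms(1,2)
        by (auto simp: tagged_def merge_pair_def Let_def add_mset_commute)
    next
      case 2
      then have "v - a - (u - a) = v - u" "u - a < b" "v - a < b" "\<not> u < a" "\<not> v < a" using uv by auto
      then show ?thesis using 2 uv assms(1,2)
        by (auto simp: tagged_def merge_pair_def Let_def add_mset_commute)
    next
      case 3
      then show ?thesis using uv assms(1,2)
        by (auto simp: tagged_def merge_pair_def Let_def add_mset_commute)
    next
      case 4
      then have "u - a - b = u - (a + b)" "v - a - b = v - (a + b)" "a \<le> u" "a \<le> v" "b \<le> u - a" "b \<le> v - a"
        using uv by auto
      then show ?thesis using 4 uv assms(1,2)
        by (auto simp: tagged_def merge_pair_def Let_def add_mset_commute)
    next
      case 5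
      define c where "c = part_at zs (v - (a + b))"
      have "c \<in># mset zs" using 5 uv by (simp add: c_def part_at_in_set)
      then have "add_mset b (mset zs) - {#c#} = add_mset b (mset zs - {#c#})" by simp
      moreover have "\<not> v - a < b" "v - a - b = v - (a + b)" using 5 by auto
      then have "part_at (b # zs) (v - a) = c" by (simp add: c_def)
      ultimately show ?thesis using 5 uv assms(1,2)
        by (auto simp: tagged_def merge_pair_def Let_def c_def[symmetric] add_mset_commute ac_simps
            simp del: part_at.simps)
    next
      case 6
      define c where "c = part_at zs (v - (a + b))"
      have "v - a - b = v - (a + b)" by simp
      then show ?thesis using 6 uv assms(1,2)
        by (auto simp: tagged_def merge_pair_def Let_def c_def[symmetric] add_mset_commute ac_simps)
    qed
  qed
  consider "u < v" | "v < u" | "u = v" by linarith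
  then show ?thesis
  proof cases
    case 1
    then show ?thesis using main assms by blast
  next
    case 2
    then show ?thesis using main[of v u] assms by (simp only: tagged_commute[of a b zs u] move_commute[of _ u v])
  next
    case 3
    then show ?thesis using assms
      by (simp add: move_same del: move.simps) (simp add: tagged_def merge_pair_def)
  qed
qed

text \<open>The Lyapunov function is written in terms of the two partitions alone, since a coupling
  does not record the tag. For a merge pair the partition with more parts minus the other one is
  \<open>{#a, b#}\<close>, and the intersection consists of the common parts.\<close>

definition pair_cost :: "nat \<Rightarrow> nat multiset \<Rightarrow> nat multiset \<Rightarrow> real" where
  "pair_cost N x y = (if x = y then 0 else
     16 + (\<Sum>c\<in>#(if size x < size y then y - x else x - y). 1 / real c)
     + real (size (x \<inter># y)) / (4 * real N))"

definition tagged_cost :: "nat \<Rightarrow> nat \<times> nat \<times> nat multiset \<Rightarrow> real" where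
  "tagged_cost N t = (case t of (a, b, z) \<Rightarrow> 16 + 1 / real a + 1 / real b + real (size z) / (4 * real N))"

text \<open>As \<open>a\<close> and \<open>b\<close> are positive, neither equals
  \<open>a + b\<close>, so multiset difference and intersection recover the tagged and the common
  parts.\<close>

lemma pair_cost_eq:
  assumes "merge_pair t x y"
  shows "x \<noteq> y" "pair_cost N x y = tagged_cost N t"
proof -
  obtain a b z where t: "t = (a, b, z)" by (cases t) auto
  have "add_mset (a + b) z \<noteq> {#a, b#} + z" for z
    by (auto dest: arg_cong[where f = size])
  moreover have "({#a, b#} + z) - add_mset (a + b) z = {#a, b#}" if "0 < a" "0 < b"
    using that by (simp add: multiset_eq_iff)
  moreover have "add_mset (a + b) z \<inter># ({#a, b#} + z) = z" if "0 < a" "0 < b"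
    using that by (auto simp: multiset_eq_iff)
  moreover have "({#a, b#} + z) \<inter># add_mset (a + b) z = z" if "0 < a" "0 < b"
    using that by (auto simp: multiset_eq_iff)
  ultimately show "x \<noteq> y" "pair_cost N x y = tagged_cost N t"
    using assms by (auto simp: t merge_pair_def pair_cost_def tagged_cost_def)
qed

section \<open>Drift of the Lyapunov function\<close>

text \<open>The sum is cut along the antidiagonal \<open>p + q = 8 * a\<close>. Each antidiagonal
  below it contributes at most 1; beyond it each of the at most \<open>a * b\<close> terms is at
  most \<open>1 / (8 * a)\<close>. This threshold makes the terms in \<open>b\<close> cancel in the
  final drift estimate.\<close>

lemma sum_inverse_rectangle_le:
  "(\<Sum>p<a. \<Sum>q<b. 1 / (real p + real q + 1)) \<le> 8 * real a + real b / 8"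
proof (cases "a = 0")
  case False
  let ?S = "{(p, q). p + q < 8 * a}"
  have fin: "finite ?S"
    by (rule finite_subset[of _ "{..<8 * a} \<times> {..<8 * a}"]) auto
  have "1 / (real p + real q + 1)
      \<le> (if p + q < 8 * a then 1 / (real p + real q + 1) else 0) + 1 / (8 * real a)" for p q
  proof (cases "p + q < 8 * a")
    case ge: False
    then have "8 * real a \<le> real p + real q + 1" by linarith
    with False show ?thesis by (simp add: ge frac_le)
  qed simp
  then have "(\<Sum>p<a. \<Sum>q<b. 1 / (real p + real q + 1))
      \<le> (\<Sum>p<a. \<Sum>q<b. (if p + q < 8 * a then 1 / (real p + real q + 1) else 0) + 1 / (8 * real a))"
    by (intro sum_mono)
  also have "\<dots> = (\<Sum>(p, q)\<in>{..<a} \<times> {..<b}. if p + q < 8 * a then 1 / (real p + real q + 1) else 0)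
      + real b / 8"
    using False by (simp add: sum.distrib sum.cartesian_product)
  also have "(\<Sum>(p, q)\<in>{..<a} \<times> {..<b}. if p + q < 8 * a then 1 / (real p + real q + 1) else 0)
      = (\<Sum>(p, q)\<in>({..<a} \<times> {..<b}) \<inter> ?S. 1 / (real p + real q + 1))"
    by (subst sum.inter_restrict) (auto intro!: sum.cong)
  also have "\<dots> \<le> (\<Sum>(p, q)\<in>?S. 1 / (real p + real q + 1))"
    by (intro sum_mono2 fin) auto
  also have "\<dots> = (\<Sum>k<8 * a. \<Sum>i\<le>k. 1 / (real i + real (k - i) + 1))"
    by (rule sum.triangle_reindex)
  also have "\<dots> = (\<Sum>k<8 * a. 1)"
  proof (intro sum.cong refl)
    fix k :: nat
    have "(\<Sum>i\<le>k. 1 / (real i + real (k - i) + 1)) = (\<Sum>i\<le>k. 1 / (real k + 1))"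
      by (intro sum.cong refl) (auto simp: of_nat_diff)
    then show "(\<Sum>i\<le>k. 1 / (real i + real (k - i) + 1)) = 1" by simp
  qed
  finally show ?thesis by simp
qed simp

text \<open>Reversing the positions within one cycle turns each half into the rectangle sum. Both
  halves put the large coefficient on \<open>a\<close>, which will be the smaller part.\<close>

lemma sum_inverse_cross_le:
  "(\<Sum>u<a. \<Sum>v<b. 1 / real (a + v - u) + 1 / real (b + u - v)) \<le> 16 * real a + real b / 4"
proof -
  have "(\<Sum>u<a. \<Sum>v<b. 1 / real (a + v - u)) = (\<Sum>v<b. \<Sum>u<a. 1 / real (a + v - u))"
    by (rule sum.swap)
  also have "\<dots> = (\<Sum>v<b. \<Sum>p<a. 1 / (real p + real v + 1))"
    by (intro sum.cong refl sum.reindex_bij_witness[of _ "\<lambda>i. a - Suc i" "\<lambda>i. a - Suc i"])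
      (auto simp: of_nat_diff algebra_simps)
  also have "\<dots> = (\<Sum>p<a. \<Sum>v<b. 1 / (real p + real v + 1))"
    by (rule sum.swap)
  finally have 1: "(\<Sum>u<a. \<Sum>v<b. 1 / real (a + v - u)) = \<dots>" .
  have 2: "(\<Sum>u<a. \<Sum>v<b. 1 / real (b + u - v)) = (\<Sum>u<a. \<Sum>q<b. 1 / (real u + real q + 1))"
    by (intro sum.cong refl sum.reindex_bij_witness[of _ "\<lambda>i. b - Suc i" "\<lambda>i. b - Suc i"])
      (auto simp: of_nat_diff algebra_simps)
  show ?thesis
    using sum_inverse_rectangle_le[where a = a and b = b] unfolding sum.distrib 1 2 by linarith
qed

text \<open>This evaluates the block of a cycle of length \<open>n\<close> against itself. The
  \<open>2 * (n - d)\<close> pairs at distance \<open>d\<close> leave a piece of length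
  \<open>n - d\<close>, so \<open>1 / (n - d)\<close> contributes 2 for each \<open>d\<close>;
  subtracting \<open>1 / n\<close> for all \<open>n * (n - 1)\<close> pairs leaves
  \<open>n - 1\<close>. The term \<open>e\<close> pays for the new common part.\<close>

lemma sum_square_tagged:
  assumes "0 < n"
    and "\<And>u v. u < n \<Longrightarrow> v < n \<Longrightarrow> f u v =
      (if u = v then t else t + e - 1 / real n + 1 / real (n - ((u - v) + (v - u))))"
  shows "(\<Sum>u<n. \<Sum>v<n. f u v) = real n ^ 2 * t + (real n - 1) + real n * (real n - 1) * e"
proof -
  define h where "h d = (if d = 0 then t else t + e - 1 / real n + 1 / real (n - d))" for d
  have "(\<Sum>u<n. \<Sum>v<n. f u v) = (\<Sum>u<n. \<Sum>v<n. h ((u - v) + (v - u)))"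
    by (intro sum.cong refl) (auto simp: assms(2) h_def)
  also have "\<dots> = real n * t + (\<Sum>d = 1..<n. 2 * real (n - d) * h d)"
    by (subst sum_square_dist) (simp add: h_def)
  also have "(\<Sum>d = 1..<n. 2 * real (n - d) * h d)
      = (\<Sum>d = 1..<n. 2 * real (n - d) * (t + e - 1 / real n) + 2)"
  proof (intro sum.cong refl)
    fix d assume "d \<in> {1..<n}"
    then have "d \<noteq> 0" "0 < real (n - d)" by auto
    then show "2 * real (n - d) * h d = 2 * real (n - d) * (t + e - 1 / real n) + 2"
      unfolding h_def if_not_P[OF \<open>d \<noteq> 0\<close>] distrib_left by (simp del: of_nat_diff)
  qed
  also have "\<dots> = real n * (real n - 1) * (t + e - 1 / real n) + 2 * (real n - 1)"
    unfolding sum.distrib sum_distrib_right[symmetric] sum_dist using assms(1) by (simp add: of_nat_diff)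
  also have "real n * (real n - 1) * (t + e - 1 / real n) = real n * (real n - 1) * (t + e) - (real n - 1)"
  proof -
    have "real n * (real n - 1) * (1 / real n) = real n - 1"
      using assms(1) by simp
    then show ?thesis by (simp only: right_diff_distrib[of _ "t + e"])
  qed
  finally show ?thesis
    by (simp add: algebra_simps power2_eq_square)
qed

lemma sum_part_at_square: "(\<Sum>w<sum_list l. real (part_at l w)) = (\<Sum>c\<leftarrow>l. real c ^ 2)"
  by (induction l) (simp_all add: sum_lessThan_add power2_eq_square)

text \<open>Merging \<open>a\<close> with a part \<open>c\<close> lowers the cost by
  \<open>1 / a - 1 / (a + c) = c / (a * (a + c))\<close>, which is at least
  \<open>c / (a * N)\<close>. Summed over the \<open>a\<close> positions \<open>u\<close> and the
  \<open>c\<close> positions \<open>w\<close> of each part \<open>c\<close>, this gives the sum of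
  squares over \<open>N\<close>; \<open>e\<close> stands for the lost common part.\<close>

lemma sum_merge_le:
  assumes "0 < a" "a + sum_list zs \<le> N"
    and f: "\<And>u w. u < a \<Longrightarrow> w < sum_list zs \<Longrightarrow> f u w =
      t - 1 / real a + 1 / real (a + part_at zs w) - e"
  shows "(\<Sum>u<a. \<Sum>w<sum_list zs. f u w)
    \<le> real a * real (sum_list zs) * (t - e) - (\<Sum>c\<leftarrow>zs. real c ^ 2) / real N"
proof -
  have "(\<Sum>u<a. \<Sum>w<sum_list zs. f u w) = (\<Sum>w<sum_list zs. \<Sum>u<a. f u w)"
    by (rule sum.swap)
  also have "\<dots> = (\<Sum>w<sum_list zs. real a * (t - 1 / real a + 1 / real (a + part_at zs w) - e))"
    by (intro sum.cong refl) (simp add: f)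
  also have "\<dots> \<le> (\<Sum>w<sum_list zs. real a * (t - e) - real (part_at zs w) / real N)"
  proof (rule sum_mono)
    fix w assume "w \<in> {..<sum_list zs}"
    then have "part_at zs w \<in> set zs" by (simp add: part_at_in_set)
    then have "a + part_at zs w \<le> N" using assms(2) member_le_sum_list[of _ zs] by fastforce
    then have "real (part_at zs w) / real N \<le> real (part_at zs w) / real (a + part_at zs w)"
      using assms(1) by (intro divide_left_mono) auto
    also have "\<dots> = 1 - real a / real (a + part_at zs w)"
    proof -
      have "real a + real (part_at zs w) \<noteq> 0" using assms(1) by linarith
      then show ?thesis by (simp add: field_simps)
    qed
    also have "\<dots> = real a * (1 / real a - 1 / real (a + part_at zs w))"
      using assms(1) by (simp add: right_diff_distrib)
    finally show "real a * (t - 1 / real a + 1 / real (a + part_at zs w) - e)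
        \<le> real a * (t - e) - real (part_at zs w) / real N"
      by (simp add: algebra_simps)
  qed
  also have "\<dots> = real a * real (sum_list zs) * (t - e) - (\<Sum>c\<leftarrow>zs. real c ^ 2) / real N"
    unfolding sum_subtractf sum_divide_distrib[symmetric] sum_part_at_square by simp
  finally show ?thesis .
qed

text \<open>The positions split into \<open>a\<close>, \<open>b\<close> and \<open>Z\<close>, giving
  nine blocks, of which the off-diagonal ones come in mirror pairs. Splitting of large common parts
  raises the number of parts, but its contribution \<open>2 * Q * e = Q / (2 * N)\<close> is
  outweighed by the loss \<open>4 * Q / N\<close> from merging them with \<open>a\<close> or
  \<open>b\<close>.\<close>

lemma sum_tagged_cost_le:
  assumes "0 < a" "0 < b" "N = a + b + sum_list zs"
  shows "(\<Sum>u<N. \<Sum>v<N. tagged_cost N (tagged a b zs u v))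
    \<le> real N ^ 2 * tagged_cost N (a, b, mset zs) + 32 * real a - real N / 4"
proof -
  define T where "T u v = tagged_cost N (tagged a b zs u v)" for u v
  define t where "t = tagged_cost N (a, b, mset zs)"
  define e where "e = 1 / (4 * real N)"
  define Z where "Z = sum_list zs"
  define Q where "Q = (\<Sum>c\<leftarrow>zs. real c ^ 2)"
  have sym: "T u v = T v u" for u v
    by (simp add: T_def tagged_commute)
  have N: "0 < N" "N = a + (b + Z)" using assms by (auto simp: Z_def)
  have size: "real (size (mset zs - {#part_at zs w#})) = real (length zs) - 1" if "w < Z" for w
    using part_at_in_set[of w zs] that
    by (cases zs) (auto simp: Z_def size_Diff_singleton simp del: part_at.simps)
  have AA: "(\<Sum>u<a. \<Sum>v<a. T u v) = real a ^ 2 * t + (real a - 1) + real a * (real a - 1) * e"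
    by (rule sum_square_tagged[OF assms(1)])
      (auto simp: T_def tagged_def t_def e_def tagged_cost_def Let_def add_divide_distrib)
  have BB: "(\<Sum>u<b. \<Sum>v<b. T (a + u) (a + v)) = real b ^ 2 * t + (real b - 1) + real b * (real b - 1) * e"
    by (rule sum_square_tagged[OF assms(2)])
      (auto simp: T_def tagged_def t_def e_def tagged_cost_def Let_def add_divide_distrib)
  \<comment> \<open>With one position in each short cycle, \<open>1 / a + 1 / b\<close> is replaced
    by the reciprocals of the two pieces of the long cycle, and the common parts stay.\<close>
  have "(\<Sum>u<a. \<Sum>v<b. T u (a + v))
      = (\<Sum>u<a. \<Sum>v<b. (1 / real (a + v - u) + 1 / real (b + u - v)) + (t - 1 / real a - 1 / real b))"
  proof (intro sum.cong refl)
    fix u v assume uv: "u \<in> {..<a}" "v \<in> {..<b}"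
    then have "a + b - (a + v - u) = b + u - v" by auto
    then show "T u (a + v) = (1 / real (a + v - u) + 1 / real (b + u - v)) + (t - 1 / real a - 1 / real b)"
      using uv by (auto simp: T_def tagged_def t_def tagged_cost_def Let_def)
  qed
  also have "\<dots> \<le> 16 * real a + real b / 4 + real a * real b * (t - 1 / real a - 1 / real b)"
    using sum_inverse_cross_le[where a = a and b = b] unfolding sum.distrib[of _ "\<lambda>_. t - 1 / real a - 1 / real b"]
    by (simp add: sum.distrib)
  also have "\<dots> = real a * real b * t + 15 * real a - 3 / 4 * real b"
    using assms(1,2) by (simp add: field_simps)
  finally have AB: "(\<Sum>u<a. \<Sum>v<b. T u (a + v)) \<le> real a * real b * t + 15 * real a - 3 / 4 * real b" .
  have BA: "(\<Sum>u<b. \<Sum>v<a. T (a + u) v) = (\<Sum>u<a. \<Sum>v<b. T u (a + v))"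
    by (subst sum.swap) (simp add: sym[of _ "_ :: nat"] cong: sum.cong)
  have AZ: "(\<Sum>u<a. \<Sum>w<Z. T u (a + (b + w))) \<le> real a * real Z * (t - e) - Q / real N"
    unfolding Z_def Q_def
  proof (rule sum_merge_le)
    fix u w assume "u < a" "w < sum_list zs"
    then show "T u (a + (b + w)) = t - 1 / real a + 1 / real (a + part_at zs w) - e"
      using size[of w] by (auto simp: T_def tagged_def t_def e_def tagged_cost_def Let_def Z_def diff_divide_distrib)
  qed (use assms in auto)
  have BZ: "(\<Sum>u<b. \<Sum>w<Z. T (a + u) (a + (b + w))) \<le> real b * real Z * (t - e) - Q / real N"
    unfolding Z_def Q_def
  proof (rule sum_merge_le)
    fix u w assume "u < b" "w < sum_list zs"
    then show "T (a + u) (a + (b + w)) = t - 1 / real b + 1 / real (b + part_at zs w) - e"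
      using size[of w] by (auto simp: T_def tagged_def t_def e_def tagged_cost_def Let_def Z_def diff_divide_distrib)
  qed (use assms in auto)
  have ZA: "(\<Sum>w<Z. \<Sum>u<a. T (a + (b + w)) u) = (\<Sum>u<a. \<Sum>w<Z. T u (a + (b + w)))"
    by (subst sum.swap) (simp add: sym[of "a + _"])
  have ZB: "(\<Sum>w<Z. \<Sum>u<b. T (a + (b + w)) (a + u)) = (\<Sum>u<b. \<Sum>w<Z. T (a + u) (a + (b + w)))"
    by (subst sum.swap) (simp add: sym[of "a + (b + _)"])
  \<comment> \<open>Here the tagged parts stay, and only the number of common parts changes.\<close>
  have "(\<Sum>u<Z. \<Sum>v<Z. T (a + (b + u)) (a + (b + v)))
      = (\<Sum>u<Z. \<Sum>v<Z. (t - real (length zs) * e) + real (size (move zs u v)) * e)"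
  proof (intro sum.cong refl)
    fix u v assume "u \<in> {..<Z}" "v \<in> {..<Z}"
    then show "T (a + (b + u)) (a + (b + v)) = (t - real (length zs) * e) + real (size (move zs u v)) * e"
      by (auto simp: T_def tagged_def t_def e_def tagged_cost_def Let_def Z_def move_same)
  qed
  also have "\<dots> = real Z ^ 2 * (t - real (length zs) * e)
      + (real Z ^ 2 * real (length zs) + 2 * Q - real Z - real Z ^ 2) * e"
    using sum_size_move[of zs]
    by (simp add: sum.distrib sum_distrib_right[symmetric] Z_def Q_def power2_eq_square)
  finally have ZZ: "(\<Sum>u<Z. \<Sum>v<Z. T (a + (b + u)) (a + (b + v)))
      = real Z ^ 2 * t + (2 * Q - real Z - real Z ^ 2) * e"
    by (simp add: algebra_simps)
  have "(\<Sum>u<N. \<Sum>v<N. T u v) =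
      (\<Sum>u<a. \<Sum>v<a. T u v) + (\<Sum>u<a. \<Sum>v<b. T u (a + v)) + (\<Sum>u<a. \<Sum>w<Z. T u (a + (b + w)))
      + (\<Sum>u<b. \<Sum>v<a. T (a + u) v) + (\<Sum>u<b. \<Sum>v<b. T (a + u) (a + v))
      + (\<Sum>u<b. \<Sum>w<Z. T (a + u) (a + (b + w)))
      + (\<Sum>w<Z. \<Sum>u<a. T (a + (b + w)) u) + (\<Sum>w<Z. \<Sum>u<b. T (a + (b + w)) (a + u))
      + (\<Sum>u<Z. \<Sum>v<Z. T (a + (b + u)) (a + (b + v)))"
    by (simp add: N(2) sum_lessThan_add sum.distrib)
  also have "\<dots> \<le> (real a ^ 2 * t + (real a - 1) + real a * (real a - 1) * e)
      + (real b ^ 2 * t + (real b - 1) + real b * (real b - 1) * e)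
      + 2 * (real a * real b * t + 15 * real a - 3 / 4 * real b)
      + 2 * (real a * real Z * (t - e) - Q / real N) + 2 * (real b * real Z * (t - e) - Q / real N)
      + (real Z ^ 2 * t + (2 * Q - real Z - real Z ^ 2) * e)"
  proof -
    have mono: "x1 + s1 + s2 + s1 + x2 + s3 + s2 + s3 + x3 \<le> x1 + x2 + 2 * c1 + 2 * c2 + 2 * c3 + x3"
      if "s1 \<le> c1" "s2 \<le> c2" "s3 \<le> c3" for x1 x2 x3 s1 s2 s3 c1 c2 c3 :: real
      using that by linarith
    show ?thesis
      unfolding AA BA BB ZA ZB ZZ by (rule mono[OF AB AZ BZ])
  qed
  also have "\<dots> = real N ^ 2 * t + 31 * real a - real b / 2 - 2 - 4 * Q / real N
      + (real a ^ 2 + real b ^ 2 - real N - 2 * real (a + b) * real Z - real Z ^ 2 + 2 * Q) * e"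
    by (simp add: N(2) power2_eq_square algebra_simps)
  also have "\<dots> \<le> real N ^ 2 * t + 31 * real a - real b / 2 - 4 * Q / real N
      + (2 * real (a + b) * real N - real N ^ 2 + 2 * Q) * e"
  proof -
    \<comment> \<open>Expanding \<open>N^2\<close> reduces this to
      \<open>a^2 + b^2 + (a + b)^2 - N \<le> 2 * (a + b) * N\<close>. The term \<open>- N^2\<close>
      kept on the right becomes the drift \<open>- N / 4\<close>.\<close>
    have "real a ^ 2 + real b ^ 2 - real N - 2 * real (a + b) * real Z - real Z ^ 2
        \<le> 2 * real (a + b) * real N - real N ^ 2"
      by (simp add: N(2) power2_eq_square algebra_simps)
    then have "(real a ^ 2 + real b ^ 2 - real N - 2 * real (a + b) * real Z - real Z ^ 2 + 2 * Q) * e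
        \<le> (2 * real (a + b) * real N - real N ^ 2 + 2 * Q) * e"
      by (intro mult_right_mono) (auto simp: e_def)
    then show ?thesis by linarith
  qed
  also have "(2 * real (a + b) * real N - real N ^ 2 + 2 * Q) * e
      = real (a + b) / 2 - real N / 4 + Q / (2 * real N)"
    using N(1) by (simp add: e_def power2_eq_square field_simps)
  \<comment> \<open>The terms in \<open>b\<close> cancel, and \<open>31 * a + a / 2\<close> is
    rounded up to \<open>32 * a\<close>.\<close>
  also have "real N ^ 2 * t + 31 * real a - real b / 2 - 4 * Q / real N
      + (real (a + b) / 2 - real N / 4 + Q / (2 * real N))
      \<le> real N ^ 2 * t + 32 * real a - real N / 4"
  proof -
    define q where "q = Q / real N"
    have "0 \<le> q"
      by (auto simp: q_def Q_def intro!: divide_nonneg_nonneg sum_list_nonneg)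
    moreover have "4 * Q / real N = 4 * q" "Q / (2 * real N) = q / 2" by (simp_all add: q_def)
    moreover have "0 \<le> real a" by simp
    ultimately show ?thesis unfolding of_nat_add by argo
  qed
  finally show ?thesis by (simp add: T_def t_def)
qed

section \<open>Coupling one step from neighbouring partitions\<close>

text \<open>The diagonal is included, so that the set stays closed under a coupled step in which the
  chains meet.\<close>

definition neighbours :: "nat \<Rightarrow> (nat multiset \<times> nat multiset) set" where
  "neighbours N = {(x, y). x \<in> partitions N \<and> y \<in> partitions N \<and> (x = y \<or> (\<exists>t. merge_pair t x y))}"

lemma merge_pair_commute: "merge_pair t x y \<longleftrightarrow> merge_pair t y x"
  by (auto simp: merge_pair_def)

lemma neighbours_commute: "(x, y) \<in> neighbours N \<Longrightarrow> (y, x) \<in> neighbours N"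
  using merge_pair_commute unfolding neighbours_def by blast

lemma pair_cost_commute: "pair_cost N x y = pair_cost N y x" if "merge_pair t x y"
  using pair_cost_eq(2)[OF that] pair_cost_eq(2)[of t y x] that merge_pair_commute by metis

text \<open>Together with \<open>merge_pair_imp_split_or_merge\<close> this identifies the merge
  pairs among partitions with the edges of the graph that defines the distance.\<close>

lemma split_or_merge_imp_merge_pair:
  assumes "split_or_merge x y" "x \<in> partitions N"
  shows "\<exists>t. merge_pair t x y"
  using assms(1) unfolding split_or_merge_def
proof (elim disjE exE conjE)
  fix a r assume *: "a \<in># x" "1 \<le> r" "r < a" "y = split_part x a r"
  then have "merge_pair (r, a - r, x - {#a#}) x y"
    by (auto simp: merge_pair_def split_part_def)
  then show ?thesis ..
next
  fix a b assume *: "{#a, b#} \<subseteq># x" "y = merge_parts x a b"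
  then obtain z where z: "x = {#a, b#} + z" by (auto simp: mset_subset_eq_exists_conv)
  with assms(2) have "0 < a" "0 < b" by (auto simp: partitions_def)
  with * z have "merge_pair (a, b, z) x y"
    by (auto simp: merge_pair_def merge_parts_def)
  then show ?thesis ..
qed

lemma merge_pair_imp_split_or_merge:
  assumes "merge_pair t x y"
  shows "split_or_merge x y"
proof -
  obtain a b z where t: "t = (a, b, z)" by (cases t) auto
  have ab: "0 < a" "0 < b" using assms by (auto simp: t merge_pair_def)
  from assms consider "x = add_mset (a + b) z" "y = {#a, b#} + z" | "y = add_mset (a + b) z" "x = {#a, b#} + z"
    by (auto simp: t merge_pair_def)
  then show ?thesis
  proof cases
    case 1
    then have "a + b \<in># x \<and> 1 \<le> a \<and> a < a + b \<and> y = split_part x (a + b) a"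
      using ab by (auto simp: split_part_def)
    then show ?thesis unfolding split_or_merge_def by blast
  next
    case 2
    then have "{#a, b#} \<subseteq># x \<and> y = merge_parts x a b"
      by (auto simp: merge_parts_def)
    then show ?thesis unfolding split_or_merge_def by blast
  qed
qed

lemma size_le_of_partition:
  assumes "x \<in> partitions N"
  shows "size x \<le> N"
proof -
  have "size y \<le> sum_mset y" if "\<forall>c\<in>#y. 0 < c" for y :: "nat multiset"
    using that by (induction y) (auto simp: Suc_le_eq)
  then show ?thesis using assms by (auto simp: partitions_def)
qed

text \<open>
  The two chains use the same uniformly random transposition, except that on \<open>a \<le> b\<close> of the diagonal
  pairs, where the first chain stays, the second one merges \<open>a\<close> and \<open>b\<close>, and on \<open>a\<close> of the pairs where
  the first chain splits \<open>a + b\<close> into \<open>a\<close> and \<open>b\<close>, the second one stays. In these \<open>2 a\<close> cases they meet.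
\<close>

lemma ordered_step_coupling:
  assumes ab: "0 < a" "a \<le> b"
    and x: "x = add_mset (a + b) z" "x \<in> partitions N" and y: "y = {#a, b#} + z"
  shows "\<exists>\<pi>\<in>couplings (split_merge_kernel N x) (split_merge_kernel N y).
    finite (set_pmf \<pi>) \<and> set_pmf \<pi> \<subseteq> neighbours N \<and>
    measure_pmf.expectation \<pi> (\<lambda>(x, y). of_bool (x \<noteq> y)) \<le> 1 - 1 / real N ^ 2 \<and>
    measure_pmf.expectation \<pi> (\<lambda>(x, y). pair_cost N x y) \<le> (1 - 1 / (76 * real N)) * pair_cost N x y"
proof -
  obtain zs where zs: "mset zs = z" using ex_mset by blast
  define lx ly where "lx = (a + b) # zs" and "ly = a # b # zs"
  have lxy: "mset lx = x" "mset ly = y" by (simp_all add: lx_def ly_def x y zs)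
  have y': "y \<in> partitions N" using x y ab by (auto simp: partitions_def)
  have N: "N = a + b + sum_list zs" using x by (simp add: partitions_def flip: zs sum_mset_sum_list)
  then have "0 < N" using ab by simp
  \<comment> \<open>For \<open>u < a\<close> this involution swaps \<open>u\<close> and
    \<open>a + u\<close>, so \<open>(u, \<sigma> u v)\<close> is again uniform. The pair
    \<open>(u, u)\<close> leaves a partition in place; \<open>(u, a + u)\<close> splits
    \<open>a\<close> off in the layout \<open>lx\<close> and merges \<open>a\<close> with
    \<open>b\<close> in \<open>ly\<close>, because \<open>u < a \<le> b\<close>.\<close>
  define \<sigma> where "\<sigma> u v = (if u < a then if v = u then a + u else if v = a + u then u else v else v)" for u v
  let ?S = "{..<N} \<times> {..<N}"
  define \<pi> where "\<pi> = map_pmf (\<lambda>(u, v). (move lx u v, move ly u (\<sigma> u v))) (pmf_of_set ?S)"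
  have S: "finite ?S" "?S \<noteq> {}" using \<open>0 < N\<close> by auto
  have \<sigma>: "\<sigma> u (\<sigma> u v) = v" "v < N \<Longrightarrow> \<sigma> u v < N" for u v
    using ab N by (auto simp: \<sigma>_def)
  have bij: "bij_betw (\<lambda>(u, v). (u, \<sigma> u v)) ?S ?S"
    by (rule bij_betw_byWitness[where f' = "\<lambda>(u, v). (u, \<sigma> u v)"]) (auto simp: \<sigma>)
  have "map_pmf fst \<pi> = split_merge_kernel N x"
    using split_merge_kernel_eq[OF \<open>0 < N\<close>, of lx] x(2)
    by (simp add: \<pi>_def map_pmf_comp case_prod_unfold lxy)
  moreover have "map_pmf snd \<pi> = split_merge_kernel N y"
  proof -
    have "map_pmf snd \<pi> = map_pmf (\<lambda>(u, v). move ly u v) (map_pmf (\<lambda>(u, v). (u, \<sigma> u v)) (pmf_of_set ?S))"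
      by (simp add: \<pi>_def map_pmf_comp case_prod_unfold)
    also have "map_pmf (\<lambda>(u, v). (u, \<sigma> u v)) (pmf_of_set ?S) = pmf_of_set ?S"
      by (rule map_pmf_of_set_bij_betw[OF bij S(2,1)])
    finally show ?thesis
      using split_merge_kernel_eq[OF \<open>0 < N\<close>, of ly] y' by (simp add: lxy)
  qed
  ultimately have coupling: "\<pi> \<in> couplings (split_merge_kernel N x) (split_merge_kernel N y)"
    by (simp add: couplings_def)
  define meet where "meet u v \<longleftrightarrow> u < a \<and> (v = u \<or> v = a + u)" for u v
  have meet: "move lx u v = move ly u (\<sigma> u v)" if "meet u v" for u v
  proof -
    have u: "u < a" "u < a + b" "u < b" "u < N" using that ab N by (auto simp: meet_def)
    have "move lx u u = mset lx" "move ly u u = mset ly"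
      using u N by (simp_all add: lx_def ly_def move_same del: move.simps)
    moreover have "move ly u (a + u) = mset lx"
      using u by (simp add: lx_def ly_def Let_def)
    moreover have "move lx u (a + u) = mset ly"
      using u ab by (simp add: lx_def ly_def)
    ultimately show ?thesis
      using that by (auto simp: meet_def \<sigma>_def)
  qed
  have pair: "merge_pair (tagged a b zs u v) (move lx u v) (move ly u v)" if "u < N" "v < N" for u v
    unfolding lx_def ly_def using ab that N by (intro move_merge_pair) auto
  have not_meet: "move ly u (\<sigma> u v) = move ly u v" if "\<not> meet u v" for u v
    using that by (auto simp: meet_def \<sigma>_def)
  have "set_pmf \<pi> = (\<lambda>(u, v). (move lx u v, move ly u (\<sigma> u v))) ` ?S"
    using S by (simp add: \<pi>_def)
  moreover have "(move lx u v, move ly u (\<sigma> u v)) \<in> neighbours N" if "u < N" "v < N" for u v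
  proof -
    have "move lx u v \<in> partitions N" "move ly u (\<sigma> u v) \<in> partitions N"
      using that \<sigma>(2) x(2) y' by (auto intro!: move_in_partitions simp: lxy)
    moreover have "move lx u v = move ly u (\<sigma> u v) \<or> (\<exists>t. merge_pair t (move lx u v) (move ly u (\<sigma> u v)))"
      using meet not_meet pair[OF that] by metis
    ultimately show ?thesis by (simp add: neighbours_def)
  qed
  ultimately have supp: "finite (set_pmf \<pi>)" "set_pmf \<pi> \<subseteq> neighbours N"
    using S(1) by auto
  have E: "measure_pmf.expectation \<pi> f = (\<Sum>u<N. \<Sum>v<N. f (move lx u v, move ly u (\<sigma> u v))) / real N ^ 2"
    for f :: "nat multiset \<times> nat multiset \<Rightarrow> real"
    using S by (simp add: \<pi>_def integral_pmf_of_set case_prod_unfold power2_eq_square sum.cartesian_product)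
  have meets: "(\<Sum>u<N. \<Sum>v<N. of_bool (meet u v)) = 2 * real a"
  proof -
    have row: "(\<Sum>v<N. of_bool (meet u v) :: real) = (if u < a then 2 else 0)" if "u < N" for u
    proof -
      have "(\<Sum>v<N. of_bool (meet u v) :: real) = real (card ({..<N} \<inter> {v. meet u v}))"
        by (simp add: sum_of_bool_eq)
      also have "{..<N} \<inter> {v. meet u v} = (if u < a then {u, a + u} else {})"
        using ab N by (auto simp: meet_def)
      finally show ?thesis using ab by simp
    qed
    have "(\<Sum>u<N. \<Sum>v<N. of_bool (meet u v) :: real) = (\<Sum>u<N. if u < a then 2 else 0)"
      by (intro sum.cong refl row) simp
    also have "\<dots> = (\<Sum>u<a. 2)"
      using N by (intro sum.mono_neutral_cong_right) auto
    also have "\<dots> = 2 * real a" by simp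
    finally show ?thesis .
  qed
  have "(\<Sum>u<N. \<Sum>v<N. of_bool (move lx u v \<noteq> move ly u (\<sigma> u v)) :: real)
      \<le> (\<Sum>u<N. \<Sum>v<N. 1 - of_bool (meet u v))"
    using meet by (intro sum_mono) auto
  also have "\<dots> = real N ^ 2 - 2 * real a"
    unfolding sum_subtractf meets by (simp add: power2_eq_square)
  also have "\<dots> \<le> real N ^ 2 - 1" using ab by simp
  finally have E1: "measure_pmf.expectation \<pi> (\<lambda>(x, y). of_bool (x \<noteq> y)) \<le> 1 - 1 / real N ^ 2"
    using \<open>0 < N\<close> unfolding E by (simp add: field_simps)
  define t where "t = tagged_cost N (a, b, z)"
  have t: "pair_cost N x y = t"
    using ab by (subst pair_cost_eq(2)[of "(a, b, z)"]) (auto simp: merge_pair_def t_def x y)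
  \<comment> \<open>The tag follows the common transposition. Where \<sigma> makes the chains meet
    instead, the true cost is 0, and at least the constant 16 is saved.\<close>
  have "pair_cost N (move lx u v) (move ly u (\<sigma> u v))
      \<le> tagged_cost N (tagged a b zs u v) - 16 * of_bool (meet u v)" if "u < N" "v < N" for u v
  proof (cases "meet u v")
    case True
    have "16 \<le> tagged_cost N (tagged a b zs u v)"
      by (auto simp: tagged_cost_def split: prod.split)
    then show ?thesis using meet[OF True] True by (simp add: pair_cost_def)
  next
    case False
    then show ?thesis using not_meet[OF False] pair_cost_eq(2)[OF pair[OF that]] by simp
  qed
  then have "(\<Sum>u<N. \<Sum>v<N. pair_cost N (move lx u v) (move ly u (\<sigma> u v)))
      \<le> (\<Sum>u<N. \<Sum>v<N. tagged_cost N (tagged a b zs u v) - 16 * of_bool (meet u v))"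
    by (intro sum_mono) auto
  also have "\<dots> = (\<Sum>u<N. \<Sum>v<N. tagged_cost N (tagged a b zs u v)) - 32 * real a"
    unfolding sum_subtractf sum_distrib_left[symmetric] meets by simp
  \<comment> \<open>The savings \<open>16 * 2 * a\<close> cancel the positive term
    \<open>32 * a\<close> of the drift exactly; this fixes the constant 16.\<close>
  also have "\<dots> \<le> real N ^ 2 * t - real N / 4"
    using sum_tagged_cost_le[of a b N zs] ab N by (simp add: t_def zs)
  finally have "measure_pmf.expectation \<pi> (\<lambda>(x, y). pair_cost N x y) \<le> (real N ^ 2 * t - real N / 4) / real N ^ 2"
    unfolding E by (auto intro: divide_right_mono)
  also have "\<dots> = t - 1 / (4 * real N)"
    using \<open>0 < N\<close> by (simp add: field_simps power2_eq_square)
  \<comment> \<open>The cost is at most \<open>16 + 1 + 1 + 1 = 19\<close>, so the decrease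
    \<open>1 / (4 * N) = 19 / (76 * N)\<close> is at least \<open>t / (76 * N)\<close>.\<close>
  also have "\<dots> \<le> (1 - 1 / (76 * real N)) * t"
  proof -
    have "size z \<le> N" using size_le_of_partition[OF x(2)] by (simp add: x)
    then have "real (size z) / (4 * real N) \<le> 1"
      using \<open>0 < N\<close> by simp
    moreover have "1 / real a \<le> 1" "1 / real b \<le> 1" using ab by simp_all
    ultimately have "t \<le> 19" by (simp add: t_def tagged_cost_def)
    then have "t / (76 * real N) \<le> 19 / (76 * real N)"
      by (intro divide_right_mono) auto
    then show ?thesis by (simp add: left_diff_distrib)
  qed
  finally have "measure_pmf.expectation \<pi> (\<lambda>(x, y). pair_cost N x y) \<le> (1 - 1 / (76 * real N)) * pair_cost N x y"
    by (simp add: t)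
  with coupling supp E1 show ?thesis by blast
qed

text \<open>One coupling serves both positivity and the uniform estimate. Equal states move
  together; otherwise the parts are named so that \<open>a \<le> b\<close>, and the coupling is
  transposed if the second partition is the merged one.\<close>

lemma step_coupling:
  assumes "0 < N" "(x, y) \<in> neighbours N"
  shows "\<exists>\<pi>\<in>couplings (split_merge_kernel N x) (split_merge_kernel N y).
    finite (set_pmf \<pi>) \<and> set_pmf \<pi> \<subseteq> neighbours N \<and>
    measure_pmf.expectation \<pi> (\<lambda>(x, y). of_bool (x \<noteq> y)) \<le> (1 - 1 / real N ^ 2) * of_bool (x \<noteq> y) \<and>
    measure_pmf.expectation \<pi> (\<lambda>(x, y). pair_cost N x y) \<le> (1 - 1 / (76 * real N)) * pair_cost N x y"
proof (cases "x = y")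
  case True
  obtain l where l: "mset l = x" using ex_mset by blast
  have x: "x \<in> partitions N" using assms(2) by (simp add: neighbours_def)
  have set: "set_pmf (split_merge_kernel N x) = (\<lambda>(u, v). move l u v) ` ({..<N} \<times> {..<N})"
    using assms(1) x split_merge_kernel_eq[of N l] by (simp add: l lessThan_empty_iff)
  then have fin: "finite (set_pmf (split_merge_kernel N x))" by simp
  define \<pi> where "\<pi> = map_pmf (\<lambda>w. (w, w)) (split_merge_kernel N x)"
  have "\<pi> \<in> couplings (split_merge_kernel N x) (split_merge_kernel N y)"
    by (simp add: \<pi>_def couplings_def map_pmf_comp True)
  moreover have "finite (set_pmf \<pi>)" using fin by (simp add: \<pi>_def)
  moreover have "set_pmf \<pi> \<subseteq> neighbours N"
    using set x by (auto simp: \<pi>_def neighbours_def l intro!: move_in_partitions)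
  moreover have "measure_pmf.expectation \<pi> (\<lambda>(x, y). of_bool (x \<noteq> y)) = (0::real)"
    "measure_pmf.expectation \<pi> (\<lambda>(x, y). pair_cost N x y) = 0"
    by (simp_all add: \<pi>_def pair_cost_def)
  ultimately show ?thesis by (intro bexI[of _ \<pi>]) (auto simp: True pair_cost_def)
next
  case False
  have part: "x \<in> partitions N" "y \<in> partitions N" using assms(2) by (auto simp: neighbours_def)
  have "\<exists>a b z. 0 < a \<and> a \<le> b \<and> merge_pair (a, b, z) x y"
  proof -
    from False assms(2) obtain a b z where "merge_pair (a, b, z) x y"
      by (auto simp: neighbours_def)
    then have "merge_pair (a, b, z) x y" "merge_pair (b, a, z) x y" "0 < a" "0 < b"
      by (auto simp: merge_pair_def add.commute add_mset_commute)
    then show ?thesis using nat_le_linear by blast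
  qed
  then obtain a b z where t: "0 < a" "a \<le> b" "merge_pair (a, b, z) x y" by blast
  then consider "x = add_mset (a + b) z" "y = {#a, b#} + z" | "y = add_mset (a + b) z" "x = {#a, b#} + z"
    by (auto simp: merge_pair_def)
  then show ?thesis
  proof cases
    case 1
    from ordered_step_coupling[OF t(1,2) 1(1) part(1) 1(2)] False show ?thesis by simp
  next
    case 2
    from ordered_step_coupling[OF t(1,2) 2(1) part(2) 2(2)] obtain \<pi> where
      \<pi>: "\<pi> \<in> couplings (split_merge_kernel N y) (split_merge_kernel N x)"
        "finite (set_pmf \<pi>)" "set_pmf \<pi> \<subseteq> neighbours N"
        "measure_pmf.expectation \<pi> (\<lambda>(x, y). of_bool (x \<noteq> y)) \<le> 1 - 1 / real N ^ 2"
        "measure_pmf.expectation \<pi> (\<lambda>(x, y). pair_cost N x y) \<le> (1 - 1 / (76 * real N)) * pair_cost N y x"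
      by blast
    define \<pi>' where "\<pi>' = map_pmf (\<lambda>(x, y). (y, x)) \<pi>"
    have "\<pi>' \<in> couplings (split_merge_kernel N x) (split_merge_kernel N y)"
      using \<pi>(1) by (simp add: \<pi>'_def couplings_def map_pmf_comp case_prod_unfold)
    moreover have "finite (set_pmf \<pi>')" using \<pi>(2) by (simp add: \<pi>'_def)
    moreover have "set_pmf \<pi>' \<subseteq> neighbours N"
      using \<pi>(3) neighbours_commute by (auto simp: \<pi>'_def)
    moreover have "measure_pmf.expectation \<pi>' (\<lambda>(x, y). of_bool (x \<noteq> y) :: real)
        = measure_pmf.expectation \<pi> (\<lambda>(x, y). of_bool (x \<noteq> y))"
      by (auto simp: \<pi>'_def case_prod_unfold intro!: Bochner_Integration.integral_cong)
    moreover have "measure_pmf.expectation \<pi>' (\<lambda>(x, y). pair_cost N x y)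
        = measure_pmf.expectation \<pi> (\<lambda>(x, y). pair_cost N x y)"
    proof -
      \<comment> \<open>Symmetry of the cost is available for merge pairs, hence on the support of
        \<pi>.\<close>
      have "pair_cost N (snd p) (fst p) = pair_cost N (fst p) (snd p)" if "p \<in> set_pmf \<pi>" for p
      proof -
        have "fst p = snd p \<or> (\<exists>t. merge_pair t (fst p) (snd p))"
          using \<pi>(3) that by (auto simp: neighbours_def)
        then show ?thesis using pair_cost_commute by metis
      qed
      then show ?thesis
        by (auto simp: \<pi>'_def case_prod_unfold intro!: integral_cong_AE AE_pmfI)
    qed
    moreover have "pair_cost N y x = pair_cost N x y"
      using pair_cost_commute[OF t(3)] by simp
    ultimately show ?thesis using \<pi>(4,5) False by (intro bexI[of _ \<pi>']) auto
  qed
qed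

section \<open>The distance and path coupling\<close>

lemma split_merge_dist_le: "(split_or_merge ^^ n) x y \<Longrightarrow> split_merge_dist x y \<le> real n"
  unfolding split_merge_dist_def by (simp add: Least_le)

lemma split_merge_dist_self [simp]: "split_merge_dist x x = 0"
  using split_merge_dist_le[of 0 x x] by (simp add: split_merge_dist_def)

lemma split_merge_dist_path:
  assumes "x \<in> partitions N" "y \<in> partitions N"
  obtains n where "(split_or_merge ^^ n) x y" "split_merge_dist x y = real n"
  using LeastI_ex[OF split_or_merge_connected[OF assms]] by (auto simp: split_merge_dist_def)

lemma split_merge_dist_triangle:
  assumes "x \<in> partitions N" "y \<in> partitions N" "z \<in> partitions N"
  shows "split_merge_dist x z \<le> split_merge_dist x y + split_merge_dist y z"
proof -
  obtain m n where m: "(split_or_merge ^^ m) x y" "split_merge_dist x y = real m"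
    and n: "(split_or_merge ^^ n) y z" "split_merge_dist y z = real n"
    using split_merge_dist_path assms by metis
  have "(split_or_merge ^^ (m + n)) x z"
    using m(1) n(1) by (auto simp: relpowp_add)
  from split_merge_dist_le[OF this] show ?thesis using m n by simp
qed

text \<open>This is path coupling. On neighbours \<phi> dominates the distance, so their expected
  distance after \<open>k\<close> steps is at most \<open>\<rho> ^ k * B\<close>; gluing along a
  shortest path of length \<open>n\<close> multiplies this by \<open>n\<close>, the distance by
  which the curvature divides.\<close>

lemma curvature_ge_of_contraction:
  fixes \<phi> :: "nat multiset \<times> nat multiset \<Rightarrow> real"
  assumes N: "0 < N"
    and step: "\<And>p. p \<in> neighbours N \<Longrightarrow>
      \<exists>\<pi>\<in>couplings (split_merge_kernel N (fst p)) (split_merge_kernel N (snd p)).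
        finite (set_pmf \<pi>) \<and> set_pmf \<pi> \<subseteq> neighbours N \<and> measure_pmf.expectation \<pi> \<phi> \<le> \<rho> * \<phi> p"
    and \<phi>: "\<And>x. \<phi> (x, x) = 0" "\<And>x y t. merge_pair t x y \<Longrightarrow> 1 \<le> \<phi> (x, y)"
      "\<And>x y. (x, y) \<in> neighbours N \<Longrightarrow> \<phi> (x, y) \<le> B"
    and "0 \<le> \<rho>" "0 \<le> B"
  shows "1 - \<rho> ^ k * B \<le> split_merge_curvature N k"
proof -
  let ?P = "iterate_kernel (split_merge_kernel N) k"
  let ?E = "\<lambda>\<pi>. measure_pmf.expectation \<pi> (\<lambda>(x, y). split_merge_dist x y)"
  have neighbour: "\<exists>\<pi>\<in>couplings (?P x) (?P y). finite (set_pmf \<pi>) \<and>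
      set_pmf \<pi> \<subseteq> partitions N \<times> partitions N \<and> ?E \<pi> \<le> \<rho> ^ k * \<phi> (x, y)"
    if xy: "(x, y) \<in> neighbours N" for x y
  proof -
    from iterate_coupling[OF step \<open>0 \<le> \<rho>\<close> xy] obtain \<pi> where
      \<pi>: "\<pi> \<in> couplings (?P x) (?P y)" "finite (set_pmf \<pi>)" "set_pmf \<pi> \<subseteq> neighbours N"
        "measure_pmf.expectation \<pi> \<phi> \<le> \<rho> ^ k * \<phi> (x, y)"
      by blast
    have "split_merge_dist u v \<le> \<phi> (u, v)" if uv: "(u, v) \<in> neighbours N" for u v
    proof (cases "u = v")
      case False
      then obtain t where t: "merge_pair t u v" using uv by (auto simp: neighbours_def)
      then have "(split_or_merge ^^ 1) u v"
        using merge_pair_imp_split_or_merge by (simp only: relpowp_1)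
      from split_merge_dist_le[OF this] \<phi>(2)[OF t] show ?thesis by simp
    qed (simp add: \<phi>(1))
    then have "?E \<pi> \<le> measure_pmf.expectation \<pi> \<phi>"
      using \<pi>(2,3) by (intro integral_mono_AE AE_pmfI integrable_measure_pmf_finite) auto
    moreover have "neighbours N \<subseteq> partitions N \<times> partitions N" by (auto simp: neighbours_def)
    ultimately show ?thesis using \<pi> by (intro bexI[of _ \<pi>]) auto
  qed
  have path: "\<exists>\<pi>\<in>couplings (?P x) (?P y). finite (set_pmf \<pi>) \<and>
      set_pmf \<pi> \<subseteq> partitions N \<times> partitions N \<and> ?E \<pi> \<le> real n * (\<rho> ^ k * B)"
    if "(split_or_merge ^^ n) x y" "x \<in> partitions N" for n x y
    using that(1)
  proof (induction n arbitrary: y)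
    case 0
    \<comment> \<open>The empty path uses the coupling of the diagonal pair, whose cost
      \<open>\<phi> (x, x)\<close> is 0.\<close>
    have "(x, x) \<in> neighbours N" using that(2) by (simp add: neighbours_def)
    from neighbour[OF this] show ?case using 0 by (simp add: \<phi>(1))
  next
    case (Suc n)
    then obtain w where w: "(split_or_merge ^^ n) x w" "split_or_merge w y" by auto
    have w_part: "w \<in> partitions N" using w(1)
    proof (induction n arbitrary: w)
      case (Suc n)
      then show ?case using split_or_merge_partitions by (metis relpowp_Suc_E)
    qed (use that(2) in simp)
    from Suc.IH[OF w(1)] obtain \<pi> where
      \<pi>: "\<pi> \<in> couplings (?P x) (?P w)" "finite (set_pmf \<pi>)"
        "set_pmf \<pi> \<subseteq> partitions N \<times> partitions N" "?E \<pi> \<le> real n * (\<rho> ^ k * B)"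
      by blast
    have wy: "(w, y) \<in> neighbours N"
      using w(2) w_part split_or_merge_partitions split_or_merge_imp_merge_pair
      by (simp add: neighbours_def)
    from neighbour[OF wy] obtain \<pi>' where
      \<pi>': "\<pi>' \<in> couplings (?P w) (?P y)" "finite (set_pmf \<pi>')"
        "set_pmf \<pi>' \<subseteq> partitions N \<times> partitions N" "?E \<pi>' \<le> \<rho> ^ k * \<phi> (w, y)"
      by blast
    have "\<rho> ^ k * \<phi> (w, y) \<le> \<rho> ^ k * B"
      using \<phi>(3)[OF wy] \<open>0 \<le> \<rho>\<close> by (intro mult_left_mono) auto
    then have "?E \<pi> + ?E \<pi>' \<le> real (Suc n) * (\<rho> ^ k * B)"
      using \<pi>(4) \<pi>'(4) by (simp add: distrib_right)
    moreover obtain \<sigma> where "\<sigma> \<in> couplings (?P x) (?P y)" "finite (set_pmf \<sigma>)"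
        "set_pmf \<sigma> \<subseteq> partitions N \<times> partitions N" "?E \<sigma> \<le> ?E \<pi> + ?E \<pi>'"
      using glue_couplings[OF \<pi>(1-3) \<pi>'(1-3), of split_merge_dist] split_merge_dist_triangle
      by blast
    ultimately show ?case by (intro bexI[of _ \<sigma>]) auto
  qed
  have "1 - \<rho> ^ k * B \<le> curvature_at (split_merge_kernel N) split_merge_dist k x y"
    if xy: "x \<in> partitions N" "y \<in> partitions N" for x y
  proof (cases "x = y")
    case True
    then show ?thesis using assms(6,7) by (simp add: curvature_at_def)
  next
    case False
    obtain n where n: "(split_or_merge ^^ n) x y" "split_merge_dist x y = real n"
      using split_merge_dist_path[OF xy] .
    then have "0 < n" using False by (cases n) auto
    from path[OF n(1) xy(1)] obtain \<pi> where
      \<pi>: "\<pi> \<in> couplings (?P x) (?P y)" "?E \<pi> \<le> real n * (\<rho> ^ k * B)"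
      by blast
    \<comment> \<open>The infimum in \<open>W1\<close> is taken in the reals, so it can be compared
      with one coupling only after a lower bound is known.\<close>
    have "bdd_below (?E ` couplings (?P x) (?P y))"
      by (rule bdd_belowI2[of _ 0]) (auto intro!: integral_nonneg_AE AE_pmfI simp: split_merge_dist_def)
    then have "W1 split_merge_dist (?P x) (?P y) \<le> ?E \<pi>"
      unfolding W1_def using \<pi>(1) by (intro cINF_lower)
    also note \<pi>(2)
    finally have "W1 split_merge_dist (?P x) (?P y) / real n \<le> \<rho> ^ k * B"
      using \<open>0 < n\<close> by (simp add: divide_le_eq mult.commute)
    then show ?thesis using False n(2) by (simp add: curvature_at_def)
  qed
  \<comment> \<open>The partition into ones shows that the infimum runs over a nonempty set.\<close>
  moreover have "replicate_mset N 1 \<in> partitions N"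
    by (auto simp: partitions_def)
  ultimately show ?thesis
    unfolding split_merge_curvature_def curvature_def by (intro cINF_greatest) auto
qed

section \<open>Positivity and the uniform bound, with explicit constants\<close>

theorem proposition4p1:
  "(\<forall>N::nat. N \<ge> 1 \<longrightarrow>
      split_merge_curvature N 1 > 0 \<and> (\<forall>i::nat. i \<ge> 1 \<longrightarrow> split_merge_curvature N i > 0)) \<and>
   (\<exists>(\<alpha>::real) (\<beta>::real). \<alpha> > 0 \<and> 0 < \<beta> \<and> \<beta> < 1 \<and>
      (\<forall>(N::nat) (k::nat). N \<ge> 1 \<longrightarrow> real k \<ge> (\<alpha> + 1/2) * real N \<longrightarrow>
         split_merge_curvature N k \<ge> \<beta>))"
proof -
  have pos: "0 < split_merge_curvature N i" if N: "1 \<le> N" and i: "1 \<le> i" for N i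
  proof -
    define \<rho> where "\<rho> = 1 - 1 / real N ^ 2"
    have \<rho>: "0 \<le> \<rho>" "\<rho> < 1" using N by (auto simp: \<rho>_def)
    have "1 - \<rho> ^ i * 1 \<le> split_merge_curvature N i"
    \<comment> \<open>On neighbours this indicator equals the distance, and it contracts by
      \<open>1 - 1 / N^2\<close>.\<close>
    proof (rule curvature_ge_of_contraction[where \<phi> = "\<lambda>(x, y). of_bool (x \<noteq> y)"])
      fix p assume "p \<in> neighbours N"
      then obtain x y where p: "p = (x, y)" "(x, y) \<in> neighbours N" by (cases p) auto
      from step_coupling[OF _ p(2)] N
      show "\<exists>\<pi>\<in>couplings (split_merge_kernel N (fst p)) (split_merge_kernel N (snd p)).
          finite (set_pmf \<pi>) \<and> set_pmf \<pi> \<subseteq> neighbours N \<and>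
          measure_pmf.expectation \<pi> (\<lambda>(x, y). of_bool (x \<noteq> y)) \<le> \<rho> * (case p of (x, y) \<Rightarrow> of_bool (x \<noteq> y))"
        unfolding p(1) \<rho>_def prod.case fst_conv snd_conv by auto
    next
      fix x y t assume "merge_pair t x y"
      from pair_cost_eq(1)[OF this]
      show "(1 :: real) \<le> (case (x, y) of (x, y) \<Rightarrow> of_bool (x \<noteq> y))" by simp
    qed (use N \<rho>(1) in simp_all)
    moreover have "\<rho> ^ i < 1" using \<rho> i by (simp add: power_less_one_iff)
    ultimately show ?thesis by simp
  qed
  have "1 / 2 \<le> split_merge_curvature N k" if N: "1 \<le> N" and k: "(76 + 1 / 2) * real N \<le> real k" for N k
  proof -
    define \<rho> where "\<rho> = 1 - 1 / (76 * real N)"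
    have \<rho>: "0 \<le> \<rho>" using N by (simp add: \<rho>_def)
    have "1 - \<rho> ^ k * (19 / 16) \<le> split_merge_curvature N k"
    \<comment> \<open>Dividing the cost by 16 makes it at least 1 on merge pairs and at most
      \<open>19 / 16\<close> on neighbours.\<close>
    proof (rule curvature_ge_of_contraction[where \<phi> = "\<lambda>(x, y). pair_cost N x y / 16"])
      fix p assume "p \<in> neighbours N"
      then obtain x y where p: "p = (x, y)" "(x, y) \<in> neighbours N" by (cases p) auto
      from step_coupling[OF _ p(2)] N obtain \<pi> where
        \<pi>: "\<pi> \<in> couplings (split_merge_kernel N x) (split_merge_kernel N y)"
          "finite (set_pmf \<pi>)" "set_pmf \<pi> \<subseteq> neighbours N"
          "measure_pmf.expectation \<pi> (\<lambda>(x, y). pair_cost N x y) \<le> \<rho> * pair_cost N x y"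
        unfolding \<rho>_def by auto
      have "measure_pmf.expectation \<pi> (\<lambda>(x, y). pair_cost N x y / 16)
          = measure_pmf.expectation \<pi> (\<lambda>(x, y). pair_cost N x y) / 16"
        by (simp add: case_prod_unfold)
      with \<pi> show "\<exists>\<pi>\<in>couplings (split_merge_kernel N (fst p)) (split_merge_kernel N (snd p)).
          finite (set_pmf \<pi>) \<and> set_pmf \<pi> \<subseteq> neighbours N \<and>
          measure_pmf.expectation \<pi> (\<lambda>(x, y). pair_cost N x y / 16)
            \<le> \<rho> * (case p of (x, y) \<Rightarrow> pair_cost N x y / 16)"
        by (intro bexI[of _ \<pi>]) (simp_all add: p(1))
    next
      fix x y t assume t: "merge_pair t x y"
      have "16 \<le> tagged_cost N t"
        by (simp add: tagged_cost_def split: prod.split)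
      then show "1 \<le> (case (x, y) of (x, y) \<Rightarrow> pair_cost N x y / 16)"
        by (simp add: pair_cost_eq(2)[OF t])
    next
      fix x y assume xy: "(x, y) \<in> neighbours N"
      show "(case (x, y) of (x, y) \<Rightarrow> pair_cost N x y / 16) \<le> 19 / 16"
      proof (cases "x = y")
        case False
        then obtain a b z where t: "merge_pair (a, b, z) x y" using xy by (auto simp: neighbours_def)
        then have "x = add_mset (a + b) z \<or> x = {#a, b#} + z" "0 < a" "0 < b"
          by (auto simp: merge_pair_def)
        moreover have "size x \<le> N" using size_le_of_partition xy by (auto simp: neighbours_def)
        ultimately have "size z \<le> N" "0 < a" "0 < b" by auto
        then have "real (size z) / (4 * real N) \<le> 1" "1 / real a \<le> 1" "1 / real b \<le> 1"
          using N by simp_all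
        then show ?thesis using pair_cost_eq(2)[OF t, of N] by (simp add: tagged_cost_def)
      qed (simp add: pair_cost_def)
    qed (use N \<rho> in \<open>simp_all add: pair_cost_def[of N x x for x]\<close>)
    \<comment> \<open>The choice \<open>\<alpha> = 76\<close> makes the exponent
      \<open>k / (76 * N)\<close> at least 1.\<close>
    moreover have "\<rho> ^ k \<le> exp (- 1)"
    proof -
      have "\<rho> ^ k \<le> exp (- (1 / (76 * real N))) ^ k"
        using \<rho> exp_ge_add_one_self[of "- (1 / (76 * real N))"] by (intro power_mono) (auto simp: \<rho>_def)
      also have "\<dots> = exp (- (real k / (76 * real N)))"
        by (simp flip: exp_of_nat_mult)
      also have "\<dots> \<le> exp (- 1)"
        using N k by (simp add: field_simps)
      finally show ?thesis .
    qed
    \<comment> \<open>The value \<open>8 / 19\<close> turns the bound \<open>19 / 16\<close> into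
      \<open>1 / 2\<close>, which gives \<open>\<beta> = 1 / 2\<close>.\<close>
    moreover have "exp (- 1) \<le> (8 / 19 :: real)"
    proof -
      have "(19 / 8 :: real) \<le> (1 + 1 / 4) ^ 4"
        by (simp add: eval_nat_numeral)
      also have "\<dots> \<le> exp (1 / 4) ^ 4"
        by (intro power_mono exp_ge_add_one_self) simp
      also have "\<dots> = exp 1"
        by (simp flip: exp_of_nat_mult)
      finally have "inverse (exp 1) \<le> inverse (19 / 8 :: real)"
        by (intro le_imp_inverse_le) auto
      then show ?thesis by (simp add: exp_minus)
    qed
    ultimately show ?thesis by linarith
  qed
  with pos show ?thesis
    by (intro conjI allI impI exI[of _ 76] exI[of _ "1 / 2 :: real"]) auto
qed
end
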